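(* Let $\mathcal{T}_A:=\left\{(x,y,z)\in\mathbb{R}^3\;\middle|\;\frac14<\left(\sqrt{x^2+y^2}-2\right)^2+z^2<\frac94\right\}$. Then for any strictly positive, coprime integers $(p,q)\in\mathbb{N}^2$ there exist countably infinitely many (pairwise) distinct real analytic Riemannian metrics $(g_{p,q,k})_{k\in\mathbb{Z}}$ on $\mathcal{T}_A$ and countably infinitely many (pairwise) distinct real analytic vector fields $(\mathbf{X}_{p,q,k})_{k\in\mathbb{Z}}$ on $\mathcal{T}_A$ such that $$\mathrm{curl}_{g_{p,q,k}}\left(\mathbf{X}_{p,q,k}\right)=\mathbf{X}_{p,q,k}\quad\text{for all }k\in\mathbb{Z}$$ with respect to the standard orientation on $\mathcal{T}_A$, and such that $$\{x\in\mathcal{T}_A\mid\mathbf{X}_{p,q,k}(x)=0\}=\mathcal{T}_{p,q}\quad\text{for all }k\in\mathbb{Z},$$ where $\mathcal{T}_{p,q}$ is the $(p,q)$-torus knot. The metrics $g_{p,q,k}$ and vector fields $\mathbf{X}_{p,q,k}$ can be explicitly expressed in terms of Cartesian coordinates by means of elementary functions alone.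
   Context: $\mathcal{T}_A$ is called the (open) solid toroidal annulus; it is an open subset of $\mathbb{R}^3$ with the standard orientation of $\mathbb{R}^3$. For strictly positive coprime integers $p,q$, let $T_{p,q}:\mathbb{R}\to\mathbb{R}^3$, $T_{p,q}(t)=\left(\cos(qt)(2+\cos(pt)),\ \sin(qt)(2+\cos(pt)),\ \sin(pt)\right)$; the $(p,q)$-torus knot is the image $\mathcal{T}_{p,q}:=T_{p,q}(\mathbb{R})$. Given a Riemannian metric $g$ on an oriented $3$-manifold and a smooth vector field $\mathbf{X}$, put $\omega^1_{\mathbf{X}}:=g(\mathbf{X},\cdot)$; then $\mathrm{curl}_g(\mathbf{X})$ is the unique vector field with $\omega^1_{\mathrm{curl}_g(\mathbf{X})}=\star d\omega^1_{\mathbf{X}}$, where $\star$ is the Hodge star operator of $g$ and the orientation, and $d$ is the exterior derivative. *)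

theory Defs
  imports "HOL-Analysis.Analysis"
begin

subsection \<open>The toroidal annulus and torus knots\<close>

definition toroidal_annulus :: "(real^3) set" where
  "toroidal_annulus =
     {v. 1/4 < (sqrt ((v$1)\<^sup>2 + (v$2)\<^sup>2) - 2)\<^sup>2 + (v$3)\<^sup>2 \<and>
         (sqrt ((v$1)\<^sup>2 + (v$2)\<^sup>2) - 2)\<^sup>2 + (v$3)\<^sup>2 < 9/4}"

definition torus_curve :: "nat \<Rightarrow> nat \<Rightarrow> real \<Rightarrow> real^3" where
  "torus_curve p q t =
     vector [cos (real q * t) * (2 + cos (real p * t)),
             sin (real q * t) * (2 + cos (real p * t)),
             sin (real p * t)]"

definition torus_knot :: "nat \<Rightarrow> nat \<Rightarrow> (real^3) set" where
  "torus_knot p q = range (torus_curve p q)"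


subsection \<open>Real analytic and elementary functions of several variables\<close>

text \<open>Near every point of the set the function is the sum of a power series in the coordinates,
  indexed by multi-indices. The word \<open>has_sum\<close> means unconditional, hence absolute,
  convergence. The notion is meant for open sets.\<close>

definition real_analytic_on :: "(real^'n \<Rightarrow> real) \<Rightarrow> (real^'n) set \<Rightarrow> bool" where
  "real_analytic_on f U \<longleftrightarrow>
     (\<forall>x\<in>U. \<exists>r>0. \<exists>c :: ('n \<Rightarrow> nat) \<Rightarrow> real. \<forall>y\<in>ball x r.
        ((\<lambda>m. c m * (\<Prod>i\<in>UNIV. (y$i - x$i) ^ m i)) has_sum f y) UNIV)"

text \<open>Functions given on \<open>U\<close> by a closed formula in the Cartesian coordinates. Each operation may
  be applied only where it is defined mathematically, so that no use is made of the totalised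
  values of division, logarithm etc. General powers, the tangent, hyperbolic functions
  and so on are compositions of the listed ones.\<close>

inductive elementary_on :: "(real^'n) set \<Rightarrow> (real^'n \<Rightarrow> real) \<Rightarrow> bool"
  for U :: "(real^'n) set"
where
  const: "elementary_on U (\<lambda>x. c)"
| coordinate: "elementary_on U (\<lambda>x. x $ i)"
| add: "elementary_on U f \<Longrightarrow> elementary_on U g \<Longrightarrow> elementary_on U (\<lambda>x. f x + g x)"
| mult: "elementary_on U f \<Longrightarrow> elementary_on U g \<Longrightarrow> elementary_on U (\<lambda>x. f x * g x)"
| divide: "elementary_on U f \<Longrightarrow> elementary_on U g \<Longrightarrow> (\<And>x. x \<in> U \<Longrightarrow> g x \<noteq> 0)
    \<Longrightarrow> elementary_on U (\<lambda>x. f x / g x)"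
| root: "elementary_on U f \<Longrightarrow> n > 0 \<Longrightarrow> (\<And>x. x \<in> U \<Longrightarrow> f x \<ge> 0)
    \<Longrightarrow> elementary_on U (\<lambda>x. root n (f x))"
| exp: "elementary_on U f \<Longrightarrow> elementary_on U (\<lambda>x. exp (f x))"
| ln: "elementary_on U f \<Longrightarrow> (\<And>x. x \<in> U \<Longrightarrow> f x > 0) \<Longrightarrow> elementary_on U (\<lambda>x. ln (f x))"
| sin: "elementary_on U f \<Longrightarrow> elementary_on U (\<lambda>x. sin (f x))"
| cos: "elementary_on U f \<Longrightarrow> elementary_on U (\<lambda>x. cos (f x))"
| arcsin: "elementary_on U f \<Longrightarrow> (\<And>x. x \<in> U \<Longrightarrow> \<bar>f x\<bar> \<le> 1)
    \<Longrightarrow> elementary_on U (\<lambda>x. arcsin (f x))"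
| arccos: "elementary_on U f \<Longrightarrow> (\<And>x. x \<in> U \<Longrightarrow> \<bar>f x\<bar> \<le> 1)
    \<Longrightarrow> elementary_on U (\<lambda>x. arccos (f x))"
| arctan: "elementary_on U f \<Longrightarrow> elementary_on U (\<lambda>x. arctan (f x))"
| cong: "elementary_on U f \<Longrightarrow> (\<And>x. x \<in> U \<Longrightarrow> g x = f x) \<Longrightarrow> elementary_on U g"


subsection \<open>Metrics and vector fields on open subsets of three-space\<close>

type_synonym bilinear_form = "real^3 \<Rightarrow> real^3 \<Rightarrow> real"
type_synonym metric_field = "real^3 \<Rightarrow> bilinear_form"
type_synonym vector_field = "real^3 \<Rightarrow> real^3"

definition is_inner_product :: "bilinear_form \<Rightarrow> bool" where
  "is_inner_product m \<longleftrightarrow>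
     bilinear m \<and> (\<forall>v w. m v w = m w v) \<and> (\<forall>v. v \<noteq> 0 \<longrightarrow> m v v > 0)"

definition metric_component :: "metric_field \<Rightarrow> 3 \<Rightarrow> 3 \<Rightarrow> real^3 \<Rightarrow> real" where
  "metric_component g i j x = g x (axis i 1) (axis j 1)"

definition analytic_riemannian_metric_on :: "metric_field \<Rightarrow> (real^3) set \<Rightarrow> bool" where
  "analytic_riemannian_metric_on g U \<longleftrightarrow>
     (\<forall>x\<in>U. is_inner_product (g x)) \<and> (\<forall>i j. real_analytic_on (metric_component g i j) U)"

definition analytic_vector_field_on :: "vector_field \<Rightarrow> (real^3) set \<Rightarrow> bool" where
  "analytic_vector_field_on X U \<longleftrightarrow> (\<forall>i. real_analytic_on (\<lambda>x. X x $ i) U)"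

definition elementary_metric_on :: "metric_field \<Rightarrow> (real^3) set \<Rightarrow> bool" where
  "elementary_metric_on g U \<longleftrightarrow> (\<forall>i j. elementary_on U (metric_component g i j))"

definition elementary_vector_field_on :: "vector_field \<Rightarrow> (real^3) set \<Rightarrow> bool" where
  "elementary_vector_field_on X U \<longleftrightarrow> (\<forall>i. elementary_on U (\<lambda>x. X x $ i))"


subsection \<open>Differential forms, Hodge star and curl\<close>

definition flat_form :: "metric_field \<Rightarrow> vector_field \<Rightarrow> real^3 \<Rightarrow> real^3 \<Rightarrow> real" where
  "flat_form g X = (\<lambda>x v. g x (X x) v)"

text \<open>The invariant formula \<open>d\<omega>(V,W) = V(\<omega>(W)) - W(\<omega>(V)) - \<omega>([V,W])\<close> for constant vector
  fields, whose bracket vanishes.\<close>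

definition ext_deriv :: "(real^3 \<Rightarrow> real^3 \<Rightarrow> real) \<Rightarrow> real^3 \<Rightarrow> bilinear_form" where
  "ext_deriv \<omega> x v w =
     frechet_derivative (\<lambda>y. \<omega> y w) (at x) v - frechet_derivative (\<lambda>y. \<omega> y v) (at x) w"

definition alternating_form :: "bilinear_form \<Rightarrow> bool" where
  "alternating_form \<beta> \<longleftrightarrow> bilinear \<beta> \<and> (\<forall>v. \<beta> v v = 0)"

definition wedge_form :: "bilinear_form \<Rightarrow> (real^3 \<Rightarrow> real) \<Rightarrow> real^3 \<Rightarrow> real^3 \<Rightarrow> real^3 \<Rightarrow> real" where
  "wedge_form \<eta> \<alpha> u v w = \<eta> u v * \<alpha> w + \<eta> v w * \<alpha> u + \<eta> w u * \<alpha> v"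

definition gram_matrix :: "bilinear_form \<Rightarrow> real^3^3" where
  "gram_matrix m = (\<chi> i j. m (axis i 1) (axis j 1))"

text \<open>The Riemannian volume form for the standard orientation: it takes the value
  \<open>sqrt (det G)\<close>, rather than its negative, on the standard basis.\<close>

definition volume_form :: "bilinear_form \<Rightarrow> real^3 \<Rightarrow> real^3 \<Rightarrow> real^3 \<Rightarrow> real" where
  "volume_form m u v w = sqrt (det (gram_matrix m)) * det (vector [u, v, w] :: real^3^3)"

text \<open>The induced inner product on 2-forms. The factor \<open>1/2\<close> makes \<open>e\<^sup>i \<and> e\<^sup>j\<close> (\<open>i < j\<close>) orthonormal
  for an orthonormal coframe.\<close>

definition form_inner :: "bilinear_form \<Rightarrow> bilinear_form \<Rightarrow> bilinear_form \<Rightarrow> real" where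
  "form_inner m \<eta> \<beta> =
     (let H = matrix_inv (gram_matrix m) in
      (1/2) * (\<Sum>i\<in>UNIV. \<Sum>j\<in>UNIV. \<Sum>k\<in>UNIV. \<Sum>l\<in>UNIV.
         H$i$k * H$j$l * \<eta> (axis i 1) (axis j 1) * \<beta> (axis k 1) (axis l 1)))"

text \<open>The Hodge star of a 2-form \<open>\<beta>\<close>: the unique 1-form with \<open>\<eta> \<and> \<star>\<beta> = \<langle>\<eta>,\<beta>\<rangle> vol\<close>
  for all 2-forms \<open>\<eta>\<close>.\<close>

definition hodge_star :: "bilinear_form \<Rightarrow> bilinear_form \<Rightarrow> real^3 \<Rightarrow> real" where
  "hodge_star m \<beta> =
     (THE \<alpha>. linear \<alpha> \<and>
        (\<forall>\<eta>. alternating_form \<eta> \<longrightarrow>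
           (\<forall>u v w. wedge_form \<eta> \<alpha> u v w = form_inner m \<eta> \<beta> * volume_form m u v w)))"

definition riemannian_curl :: "metric_field \<Rightarrow> vector_field \<Rightarrow> vector_field" where
  "riemannian_curl g X x =
     (THE Y. g x Y = hodge_star (g x) (ext_deriv (flat_form g X) x))"

end

theory Submission
  imports Defs
begin

text \<open>Let \<open>\<phi>\<close> and \<open>\<theta>\<close> be the angles around the \<open>z\<close>-axis and around the core circle \<open>R = 2\<close>, let
  \<open>N = (R - 2)\<^sup>2 + z\<^sup>2\<close>, and put \<open>s = N - 1\<close>, \<open>u = p \<phi> - q \<theta>\<close>, \<open>w = \<lambda> \<phi>\<close> with \<open>\<lambda> > 0\<close>. The forms
  \<open>ds, du, dw\<close> are a positively oriented global coframe; let \<open>g = ds\<^sup>2 + du\<^sup>2 + dw\<^sup>2\<close>. The function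
  \<open>C = cos s - cos u\<close> satisfies \<open>C\<^sub>s\<^sub>s + C\<^sub>u\<^sub>u = - C\<close>, and therefore
  \<open>\<omega> = C\<^sub>u ds - C\<^sub>s du + C dw\<close> satisfies \<open>\<star> d\<omega> = \<omega>\<close>. It vanishes exactly where \<open>sin s = sin u = 0\<close> and
  \<open>cos s = cos u\<close>; since \<open>\<bar>s\<bar> < \<pi>\<close> on the annulus this means \<open>s = 0\<close> and \<open>u \<in> 2\<pi>\<int>\<close>, which is the
  torus knot. Different \<open>\<lambda>\<close> give different metrics and fields.\<close>

section \<open>The Hodge star in three dimensions\<close>

text \<open>In the local coordinates (s, u, w) the metric is Euclidean. For a function C of s and u
  alone, d of C_u ds - C_s du + C dw equals - (C_ss + C_uu) ds du + dC dw, so the curl equation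
  becomes the planar Helmholtz equation C_ss + C_uu = - C. The zeros of the field are the critical
  points of C on its zero level. A difference of two plane waves has saddles there, isolated in the
  (s, u)-plane, and each of them sweeps out a curve in the direction of w.

  The obstacle is that the angles are multivalued. As p and q are integers, exp(iu) is
  single-valued, and C depends on u only through it. The function w occurs only through its closed
  differential, so lambda is not quantised and a continuous family of examples results. The form d
  phi completes ds and du to a coframe because q > 0, and the minus sign in u together with the
  order ds, du, dw makes the orientation positive.

  The Hodge star and the curl are given by description operators; they are never computed, only
  recognised by their characterising properties.\<close>

lemma vec3_eqI: "x $ 1 = y $ 1 \<Longrightarrow> x $ 2 = y $ 2 \<Longrightarrow> x $ 3 = y $ 3 \<Longrightarrow> x = (y :: 'a^3)"
  by (simp add: vec_eq_iff forall_3)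

lemma vec3_expand:
  fixes v :: "real^3"
  shows "v = v $ 1 *\<^sub>R axis 1 1 + v $ 2 *\<^sub>R axis 2 1 + v $ 3 *\<^sub>R axis 3 1"
  by (rule vec3_eqI) (simp_all add: axis_def)

lemma linear_expand3:
  fixes \<alpha> :: "real^3 \<Rightarrow> real"
  assumes "linear \<alpha>"
  shows "\<alpha> v = v $ 1 * \<alpha> (axis 1 1) + v $ 2 * \<alpha> (axis 2 1) + v $ 3 * \<alpha> (axis 3 1)"
  by (subst vec3_expand[of v]) (simp add: linear_add[OF assms] linear_scale[OF assms])

lemma bilinear_expand3:
  fixes \<beta> :: bilinear_form
  assumes "bilinear \<beta>"
  shows "\<beta> v w = (\<Sum>i\<in>UNIV. \<Sum>j\<in>UNIV. v $ i * w $ j * \<beta> (axis i 1) (axis j 1))"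
proof -
  have 1: "linear (\<lambda>v. \<beta> v w)" and 2: "linear (\<beta> u)" for u w
    using assms by (auto simp: bilinear_def)
  show ?thesis
    by (subst linear_expand3[OF 1], subst (1 2 3) linear_expand3[OF 2])
       (simp add: sum_3 algebra_simps)
qed

lemma alternating_form_swap:
  assumes "alternating_form \<beta>"
  shows "\<beta> v w = - \<beta> w v"
proof -
  have b: "bilinear \<beta>" and z: "\<And>v. \<beta> v v = 0"
    using assms by (auto simp: alternating_form_def)
  have "0 = \<beta> (v + w) (v + w)" by (simp add: z)
  also have "\<dots> = (\<beta> v v + \<beta> w v) + (\<beta> v w + \<beta> w w)"
    by (simp only: bilinear_ladd[OF b] bilinear_radd[OF b])
  also have "\<dots> = \<beta> v w + \<beta> w v"
    by (simp add: z)
  finally show ?thesis by linarith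
qed

lemma alternating_form_axis:
  assumes "alternating_form \<beta>"
  shows "\<beta> (axis i 1) (axis i 1) = 0" "\<beta> (axis 2 1) (axis 1 1) = - \<beta> (axis 1 1) (axis 2 1)"
    "\<beta> (axis 3 1) (axis 2 1) = - \<beta> (axis 2 1) (axis 3 1)"
    "\<beta> (axis 1 1) (axis 3 1) = - \<beta> (axis 3 1) (axis 1 1)"
  using assms by (simp add: alternating_form_def) (rule alternating_form_swap[OF assms])+

lemma alternating_expand3:
  assumes "alternating_form \<beta>"
  shows "\<beta> v w = (v $ 2 * w $ 3 - v $ 3 * w $ 2) * \<beta> (axis 2 1) (axis 3 1)
    + (v $ 3 * w $ 1 - v $ 1 * w $ 3) * \<beta> (axis 3 1) (axis 1 1)
    + (v $ 1 * w $ 2 - v $ 2 * w $ 1) * \<beta> (axis 1 1) (axis 2 1)"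
proof -
  have "bilinear \<beta>" using assms by (simp add: alternating_form_def)
  from bilinear_expand3[OF this, of v w] show ?thesis
    unfolding sum_3 alternating_form_axis[OF assms] by (simp add: algebra_simps)
qed

text \<open>Three-forms on a three-dimensional space are multiples of the determinant. The multiple
  pairs the three components of \<open>\<eta>\<close> with those of \<open>\<alpha>\<close>, so the
  condition defining the Hodge star is a linear system for three numbers.\<close>

lemma wedge_form_expand3:
  assumes "alternating_form \<eta>" "linear \<alpha>"
  shows "wedge_form \<eta> \<alpha> u v w =
    (\<eta> (axis 2 1) (axis 3 1) * \<alpha> (axis 1 1) + \<eta> (axis 3 1) (axis 1 1) * \<alpha> (axis 2 1)
      + \<eta> (axis 1 1) (axis 2 1) * \<alpha> (axis 3 1)) * det (vector [u, v, w] :: real^3^3)"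
  unfolding wedge_form_def alternating_expand3[OF assms(1), of u v]
    alternating_expand3[OF assms(1), of v w] alternating_expand3[OF assms(1), of w u]
    linear_expand3[OF assms(2), of u] linear_expand3[OF assms(2), of v] linear_expand3[OF assms(2), of w]
  by (simp add: det_3 algebra_simps)

lemma matrix_inv_unique:
  fixes A B :: "real^'n^'n"
  assumes "A ** B = mat 1"
  shows "matrix_inv A = B"
proof -
  have BA: "B ** A = mat 1"
    using assms by (rule matrix_left_right_inverse[THEN iffD1])
  then have "A ** matrix_inv A = mat 1 \<and> matrix_inv A ** A = mat 1"
    unfolding matrix_inv_def using assms by (intro someI[of "\<lambda>A'. A ** A' = mat 1 \<and> A' ** A = mat 1"]) simp
  then have "matrix_inv A = B ** (A ** matrix_inv A)"
    by (metis BA matrix_mul_assoc matrix_mul_lid)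
  then show ?thesis
    using \<open>A ** matrix_inv A = mat 1 \<and> _\<close> by simp
qed

definition adjugate3 :: "real^3^3 \<Rightarrow> real^3^3" where
  "adjugate3 G = vector [
     vector [G$2$2 * G$3$3 - G$2$3 * G$3$2, G$1$3 * G$3$2 - G$1$2 * G$3$3, G$1$2 * G$2$3 - G$1$3 * G$2$2],
     vector [G$2$3 * G$3$1 - G$2$1 * G$3$3, G$1$1 * G$3$3 - G$1$3 * G$3$1, G$1$3 * G$2$1 - G$1$1 * G$2$3],
     vector [G$2$1 * G$3$2 - G$2$2 * G$3$1, G$1$2 * G$3$1 - G$1$1 * G$3$2, G$1$1 * G$2$2 - G$1$2 * G$2$1]]"

lemma matrix_inv_3:
  fixes G :: "real^3^3"
  assumes "det G \<noteq> 0"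
  shows "matrix_inv G = (1 / det G) *\<^sub>R adjugate3 G"
proof (rule matrix_inv_unique)
  have "G ** adjugate3 G = det G *\<^sub>R mat 1"
    by (intro vec3_eqI)
       (simp_all add: matrix_matrix_mult_def sum_3 adjugate3_def mat_def det_3 algebra_simps)
  then show "G ** ((1 / det G) *\<^sub>R adjugate3 G) = mat 1"
    using assms by (simp add: matrix_scalar_ac scalar_matrix_assoc[symmetric])
qed

text \<open>The cofactors of the inverse Gram matrix are the entries of the Gram matrix
  divided by its determinant.\<close>

lemma form_inner_eq:
  assumes m: "\<And>v w. m v w = m w v" and D: "det (gram_matrix m) \<noteq> 0"
    and "alternating_form \<eta>" "alternating_form \<beta>"
  defines "\<eta>' \<equiv> vector [\<eta> (axis 2 1) (axis 3 1), \<eta> (axis 3 1) (axis 1 1), \<eta> (axis 1 1) (axis 2 1)] :: real^3"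
    and "\<beta>' \<equiv> vector [\<beta> (axis 2 1) (axis 3 1), \<beta> (axis 3 1) (axis 1 1), \<beta> (axis 1 1) (axis 2 1)] :: real^3"
  shows "form_inner m \<eta> \<beta> =
    (\<Sum>i\<in>UNIV. \<Sum>j\<in>UNIV. \<eta>' $ i * \<beta>' $ j * m (axis i 1) (axis j 1)) / det (gram_matrix m)"
proof -
  define G where "G = gram_matrix m"
  define K where "K = adjugate3 G"
  have Gm: "m (axis i 1) (axis j 1) = G $ i $ j" for i j
    by (simp add: G_def gram_matrix_def)
  have sym: "G $ 2 $ 1 = G $ 1 $ 2" "G $ 3 $ 1 = G $ 1 $ 3" "G $ 3 $ 2 = G $ 2 $ 3"
    using m by (simp_all add: G_def gram_matrix_def)
  define s where "s = (\<Sum>i\<in>UNIV. \<Sum>j\<in>UNIV. \<Sum>k\<in>UNIV. \<Sum>l\<in>UNIV.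
         K$i$k * K$j$l * \<eta> (axis i 1) (axis j 1) * \<beta> (axis k 1) (axis l 1))"
  have "form_inner m \<eta> \<beta> = s / (2 * (det G)\<^sup>2)"
    unfolding form_inner_def Let_def G_def[symmetric] matrix_inv_3[OF D[folded G_def]] K_def[symmetric] s_def
    by (simp add: sum_divide_distrib sum_distrib_left power2_eq_square)
  moreover have "s = 2 * (det G * (\<Sum>i\<in>UNIV. \<Sum>j\<in>UNIV. \<eta>' $ i * \<beta>' $ j * G $ i $ j))"
  proof -
    have K: "K $ 2 $ 2 * K $ 3 $ 3 - K $ 2 $ 3 * K $ 3 $ 2 = det G * G $ 1 $ 1"
      "K $ 1 $ 1 * K $ 3 $ 3 - K $ 1 $ 3 * K $ 3 $ 1 = det G * G $ 2 $ 2"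
      "K $ 1 $ 1 * K $ 2 $ 2 - K $ 1 $ 2 * K $ 2 $ 1 = det G * G $ 3 $ 3"
      "K $ 2 $ 3 * K $ 3 $ 1 - K $ 2 $ 1 * K $ 3 $ 3 = det G * G $ 1 $ 2"
      "K $ 2 $ 1 * K $ 3 $ 2 - K $ 2 $ 2 * K $ 3 $ 1 = det G * G $ 1 $ 3"
      "K $ 1 $ 2 * K $ 3 $ 1 - K $ 1 $ 1 * K $ 3 $ 2 = det G * G $ 2 $ 3"
      by (simp_all add: K_def adjugate3_def det_3 sym algebra_simps)
    have symK: "K $ 2 $ 1 = K $ 1 $ 2" "K $ 3 $ 1 = K $ 1 $ 3" "K $ 3 $ 2 = K $ 2 $ 3"
      by (simp_all add: K_def adjugate3_def sym algebra_simps)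
    have "det G * (\<Sum>i\<in>UNIV. \<Sum>j\<in>UNIV. \<eta>' $ i * \<beta>' $ j * G $ i $ j) =
       (\<Sum>i\<in>UNIV. \<Sum>j\<in>UNIV. \<eta>' $ i * \<beta>' $ j * (det G * G $ i $ j))"
      by (simp add: sum_distrib_left algebra_simps)
    \<comment> \<open>The reversed identities \<open>K\<close> turn each
      \<open>det G * G $ i $ j\<close> into a minor of the adjugate; what remains is the expansion
      of \<open>s\<close> over its index quadruples.\<close>
    then show ?thesis
      unfolding s_def sum_3 sym K[symmetric] \<eta>'_def \<beta>'_def vector_3
        alternating_form_axis[OF assms(3)] alternating_form_axis[OF assms(4)] symK
      by (simp add: algebra_simps)
  qed
  ultimately show ?thesis
    using D by (simp add: Gm G_def[symmetric] power2_eq_square)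
qed

text \<open>The triple product of \<open>b\<close>, \<open>v\<close> and \<open>w\<close>, that is,
  the contraction of the standard volume form with \<open>b\<close>. As \<open>b\<close> varies,
  these are the test forms that make the Hodge star unique.\<close>

definition coordinate_area :: "real^3 \<Rightarrow> bilinear_form" where
  "coordinate_area b v w = b $ 1 * (v $ 2 * w $ 3 - v $ 3 * w $ 2)
     + b $ 2 * (v $ 3 * w $ 1 - v $ 1 * w $ 3) + b $ 3 * (v $ 1 * w $ 2 - v $ 2 * w $ 1)"

lemma alternating_coordinate_area: "alternating_form (coordinate_area b)"
  unfolding alternating_form_def bilinear_def coordinate_area_def
  by (auto intro!: linearI simp: algebra_simps)

lemma coordinate_area_axis:
  "coordinate_area b (axis 2 1) (axis 3 1) = b $ 1"
  "coordinate_area b (axis 3 1) (axis 1 1) = b $ 2"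
  "coordinate_area b (axis 1 1) (axis 2 1) = b $ 3"
  by (simp_all add: coordinate_area_def axis_def)

text \<open>The hypotheses on the components of \<open>\<beta>\<close> express that it is the
  contraction of the Riemannian volume form with \<open>Y\<close>. The star of such a 2-form is the
  1-form dual to \<open>Y\<close>.\<close>

lemma hodge_star_eqI:
  assumes m: "is_inner_product m" and D: "det (gram_matrix m) > 0" and \<beta>: "alternating_form \<beta>"
    and Y: "\<beta> (axis 2 1) (axis 3 1) = sqrt (det (gram_matrix m)) * Y $ 1"
      "\<beta> (axis 3 1) (axis 1 1) = sqrt (det (gram_matrix m)) * Y $ 2"
      "\<beta> (axis 1 1) (axis 2 1) = sqrt (det (gram_matrix m)) * Y $ 3"
  shows "hodge_star m \<beta> = m Y"
proof -
  define D where "D = det (gram_matrix m)"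
  have D0: "D > 0" and DD: "sqrt D * sqrt D = D" using D by (auto simp: D_def)
  have bil: "bilinear m" and sym: "\<And>v w. m v w = m w v"
    using m by (auto simp: is_inner_product_def)
  have lin: "linear (m Y)" using bil by (simp add: bilinear_def)
  \<comment> \<open>One factor \<open>sqrt D\<close> comes from \<open>\<beta>\<close>, the other
    from the volume form; together they cancel the \<open>1 / D\<close> of
    \<open>form_inner_eq\<close>.\<close>
  have cancel: "F * sqrt D = T" if "F = sqrt D * T / D" for F T
  proof -
    have "F * sqrt D = (sqrt D * sqrt D) * T / D" 
      unfolding that times_divide_eq_left by (rule arg_cong[where f = "\<lambda>t. t / D"]) (simp only: mult_ac)
    then show ?thesis using D0 by (simp only: DD) simp
  qed
  have inner: "form_inner m \<eta> \<beta> * sqrt D =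
      \<eta> (axis 2 1) (axis 3 1) * m Y (axis 1 1) + \<eta> (axis 3 1) (axis 1 1) * m Y (axis 2 1)
      + \<eta> (axis 1 1) (axis 2 1) * m Y (axis 3 1)" if \<eta>: "alternating_form \<eta>" for \<eta>
  proof -
    have Ye: "m Y (axis i 1) = Y $ 1 * m (axis i 1) (axis 1 1) + Y $ 2 * m (axis i 1) (axis 2 1)
        + Y $ 3 * m (axis i 1) (axis 3 1)" for i
    proof -
      have "linear (\<lambda>v. m v (axis i 1))" using bil by (simp add: bilinear_def)
      from linear_expand3[OF this, of Y] show ?thesis by (simp only: sym[of "axis i 1"])
    qed
    have "form_inner m \<eta> \<beta> = sqrt D *
      (\<eta> (axis 2 1) (axis 3 1) * m Y (axis 1 1) + \<eta> (axis 3 1) (axis 1 1) * m Y (axis 2 1)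
      + \<eta> (axis 1 1) (axis 2 1) * m Y (axis 3 1)) / D"
      unfolding form_inner_eq[OF sym D[THEN less_imp_neq, symmetric] \<eta> \<beta>] Ye D_def Y vector_3 sum_3
      by (simp add: algebra_simps)
    then show ?thesis by (rule cancel)
  qed
  show ?thesis
    unfolding hodge_star_def
  proof (rule the_equality)
    show "linear (m Y) \<and> (\<forall>\<eta>. alternating_form \<eta> \<longrightarrow>
        (\<forall>u v w. wedge_form \<eta> (m Y) u v w = form_inner m \<eta> \<beta> * volume_form m u v w))"
      using lin inner by (simp add: wedge_form_expand3 volume_form_def D_def mult.assoc[symmetric])
    fix \<alpha>
    assume \<alpha>: "linear \<alpha> \<and> (\<forall>\<eta>. alternating_form \<eta> \<longrightarrow>
        (\<forall>u v w. wedge_form \<eta> \<alpha> u v w = form_inner m \<eta> \<beta> * volume_form m u v w))"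
    have det1: "det (vector [axis 1 1, axis 2 1, axis 3 1] :: real^3^3) = 1"
      by (simp add: det_3 axis_def)
    \<comment> \<open>Testing with \<open>coordinate_area b\<close> on the standard basis pairs both
      1-forms with the arbitrary vector \<open>b\<close>; the choice \<open>b = v\<close> then gives
      equality at \<open>v\<close>.\<close>
    have eq: "b $ 1 * \<alpha> (axis 1 1) + b $ 2 * \<alpha> (axis 2 1) + b $ 3 * \<alpha> (axis 3 1) =
        b $ 1 * m Y (axis 1 1) + b $ 2 * m Y (axis 2 1) + b $ 3 * m Y (axis 3 1)" for b :: "real^3"
    proof -
      note alt = alternating_coordinate_area[of b]
      have "wedge_form (coordinate_area b) \<alpha> (axis 1 1) (axis 2 1) (axis 3 1) =
          form_inner m (coordinate_area b) \<beta> * volume_form m (axis 1 1) (axis 2 1) (axis 3 1)"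
        using \<alpha> alt by blast
      then show ?thesis
        using inner[OF alt] \<alpha>
        by (simp add: wedge_form_expand3[OF alt] volume_form_def det1 coordinate_area_axis D_def)
    qed
    show "\<alpha> = m Y"
    proof
      fix v
      show "\<alpha> v = m Y v"
        using eq[of v] linear_expand3[of \<alpha> v] linear_expand3[OF lin, of v] \<alpha> by simp
    qed
  qed
qed

text \<open>The description operator in the curl selects \<open>Y\<close> because lowering an index
  is injective: if \<open>g x Z = g x Y\<close>, then \<open>Z - Y\<close> has length zero.\<close>

lemma riemannian_curl_eqI:
  assumes m: "is_inner_product (g x)" and D: "det (gram_matrix (g x)) > 0"
    and \<beta>: "alternating_form (ext_deriv (flat_form g X) x)"
    and Y: "ext_deriv (flat_form g X) x (axis 2 1) (axis 3 1) = sqrt (det (gram_matrix (g x))) * Y $ 1"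
      "ext_deriv (flat_form g X) x (axis 3 1) (axis 1 1) = sqrt (det (gram_matrix (g x))) * Y $ 2"
      "ext_deriv (flat_form g X) x (axis 1 1) (axis 2 1) = sqrt (det (gram_matrix (g x))) * Y $ 3"
  shows "riemannian_curl g X x = Y"
  unfolding riemannian_curl_def hodge_star_eqI[OF assms]
proof (rule the_equality)
  fix Z assume Z: "g x Z = g x Y"
  have "g x (Z - Y) (Z - Y) = g x Z (Z - Y) - g x Y (Z - Y)"
    using m by (simp add: is_inner_product_def bilinear_lsub)
  then have "g x (Z - Y) (Z - Y) = 0" using Z by simp
  then show "Z = Y"
    using m unfolding is_inner_product_def by (metis eq_iff_diff_eq_0 less_irrefl)
qed simp

section \<open>Metrics with a prescribed orthonormal coframe\<close>

definition coframe_metric :: "real^3 \<Rightarrow> real^3 \<Rightarrow> real^3 \<Rightarrow> bilinear_form" where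
  "coframe_metric a b c v w = (a \<bullet> v) * (a \<bullet> w) + (b \<bullet> v) * (b \<bullet> w) + (c \<bullet> v) * (c \<bullet> w)"

lemma inner_3: "(x :: real^3) \<bullet> y = x $ 1 * y $ 1 + x $ 2 * y $ 2 + x $ 3 * y $ 3"
  by (simp add: inner_vec_def sum_3)

lemma coframe_cramer:
  fixes a b c v :: "real^3"
  assumes "det (vector [a, b, c] :: real^3^3) \<noteq> 0" "a \<bullet> v = 0" "b \<bullet> v = 0" "c \<bullet> v = 0"
  shows "v = 0"
proof -
  have "det (vector [a, b, c] :: real^3^3) * v $ 1 =
      (b$2 * c$3 - b$3 * c$2) * (a \<bullet> v) + (c$2 * a$3 - c$3 * a$2) * (b \<bullet> v) + (a$2 * b$3 - a$3 * b$2) * (c \<bullet> v)"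
    "det (vector [a, b, c] :: real^3^3) * v $ 2 =
      (b$3 * c$1 - b$1 * c$3) * (a \<bullet> v) + (c$3 * a$1 - c$1 * a$3) * (b \<bullet> v) + (a$3 * b$1 - a$1 * b$3) * (c \<bullet> v)"
    "det (vector [a, b, c] :: real^3^3) * v $ 3 =
      (b$1 * c$2 - b$2 * c$1) * (a \<bullet> v) + (c$1 * a$2 - c$2 * a$1) * (b \<bullet> v) + (a$1 * b$2 - a$2 * b$1) * (c \<bullet> v)"
    by (simp_all add: det_3 inner_3 algebra_simps)
  then have "v $ 1 = 0" "v $ 2 = 0" "v $ 3 = 0"
    using assms by simp_all
  then show ?thesis by (intro vec3_eqI) simp_all
qed

lemma is_inner_product_coframe:
  assumes "det (vector [a, b, c] :: real^3^3) \<noteq> 0"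
  shows "is_inner_product (coframe_metric a b c)"
  unfolding is_inner_product_def
proof (intro conjI allI impI)
  show "bilinear (coframe_metric a b c)"
    unfolding bilinear_def coframe_metric_def
    by (auto intro!: linearI simp: inner_add_right algebra_simps)
  show "coframe_metric a b c v w = coframe_metric a b c w v" for v w
    by (simp add: coframe_metric_def algebra_simps)
  fix v :: "real^3" assume "v \<noteq> 0"
  then have "\<not> (a \<bullet> v = 0 \<and> b \<bullet> v = 0 \<and> c \<bullet> v = 0)"
    using coframe_cramer[OF assms] by blast
  moreover have "coframe_metric a b c v v = (a \<bullet> v)\<^sup>2 + (b \<bullet> v)\<^sup>2 + (c \<bullet> v)\<^sup>2"
    by (simp add: coframe_metric_def power2_eq_square)
  ultimately show "coframe_metric a b c v v > 0"
    by (metis add_pos_nonneg add_nonneg_pos zero_le_power2 zero_less_power2 add_nonneg_nonneg)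
qed

lemma det_gram_coframe:
  "det (gram_matrix (coframe_metric a b c)) = (det (vector [a, b, c] :: real^3^3))\<^sup>2"
proof -
  have "gram_matrix (coframe_metric a b c) = transpose (vector [a, b, c] :: real^3^3) ** vector [a, b, c]"
    by (intro vec3_eqI)
       (simp_all add: gram_matrix_def coframe_metric_def matrix_matrix_mult_def transpose_def sum_3
          inner_axis)
  then show ?thesis by (simp add: det_mul det_transpose power2_eq_square)
qed

text \<open>In a positively oriented orthonormal coframe the star sends b c, c a, a b to a, b, c, so
  the right-hand side of the last hypothesis is the contraction of the volume form with
  \<open>Y\<close>. Orientation enters through the sign of the determinant: the square root of the
  Gram determinant is then the determinant itself and not its negative.\<close>

lemma riemannian_curl_coframe:
  assumes g: "g x = coframe_metric a b c" and D: "det (vector [a, b, c] :: real^3^3) > 0"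
    and d: "\<And>v w. ext_deriv (flat_form g X) x v w =
      (a \<bullet> Y) * ((b \<bullet> v) * (c \<bullet> w) - (b \<bullet> w) * (c \<bullet> v))
      + (b \<bullet> Y) * ((c \<bullet> v) * (a \<bullet> w) - (c \<bullet> w) * (a \<bullet> v))
      + (c \<bullet> Y) * ((a \<bullet> v) * (b \<bullet> w) - (a \<bullet> w) * (b \<bullet> v))"
  shows "riemannian_curl g X x = Y"
proof (rule riemannian_curl_eqI)
  have s: "sqrt (det (gram_matrix (g x))) = det (vector [a, b, c] :: real^3^3)"
    using D by (simp add: g det_gram_coframe)
  show "is_inner_product (g x)" using D by (simp add: g is_inner_product_coframe)
  show "det (gram_matrix (g x)) > 0" using D by (simp add: g det_gram_coframe)
  show "alternating_form (ext_deriv (flat_form g X) x)"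
    unfolding alternating_form_def bilinear_def d
    by (auto intro!: linearI simp: inner_add_right algebra_simps)
  show "ext_deriv (flat_form g X) x (axis 2 1) (axis 3 1) = sqrt (det (gram_matrix (g x))) * Y $ 1"
    "ext_deriv (flat_form g X) x (axis 3 1) (axis 1 1) = sqrt (det (gram_matrix (g x))) * Y $ 2"
    "ext_deriv (flat_form g X) x (axis 1 1) (axis 2 1) = sqrt (det (gram_matrix (g x))) * Y $ 3"
    unfolding d s inner_axis by (simp_all add: det_3 inner_3 algebra_simps)
qed

section \<open>Power series in several variables\<close>

definition mpow :: "real^'n \<Rightarrow> ('n \<Rightarrow> nat) \<Rightarrow> real" where
  "mpow h m = (\<Prod>i\<in>UNIV. (h $ i) ^ m i)"

text \<open>A closed ball of the maximum norm: on it every monomial is bounded by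
  \<open>d ^ sum m UNIV\<close>, so a single number series dominates the power series at all
  points.\<close>

definition cube :: "real^'n \<Rightarrow> real \<Rightarrow> (real^'n) set" where
  "cube x d = {y. \<forall>i. \<bar>y $ i - x $ i\<bar> \<le> d}"

text \<open>The weighted l1-norm of the coefficients is at most \<open>S\<close>. Working with a
  bound instead of the norm itself allows terms to cancel when series are combined. This is a Banach
  algebra norm, and the lemmas below supply completeness and submultiplicativity.\<close>

definition series_on_cube :: "real^'n \<Rightarrow> real \<Rightarrow> (real^'n \<Rightarrow> real) \<Rightarrow> real \<Rightarrow> bool" where
  "series_on_cube x d f S \<longleftrightarrow>
     (\<exists>c T. ((\<lambda>m. \<bar>c m\<bar> * d ^ sum m UNIV) has_sum T) UNIV \<and> T \<le> S \<and>
        (\<forall>y\<in>cube x d. ((\<lambda>m. c m * mpow (y - x) m) has_sum f y) UNIV))"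

lemma mpow_add: "mpow h (\<lambda>i. m i + k i) = mpow h m * mpow h k"
  by (simp add: mpow_def power_add prod.distrib)

lemma abs_mpow_le:
  assumes "y \<in> cube x d"
  shows "\<bar>mpow (y - x) m\<bar> \<le> d ^ sum m UNIV"
proof -
  have "\<bar>mpow (y - x) m\<bar> = (\<Prod>i\<in>UNIV. \<bar>y $ i - x $ i\<bar> ^ m i)"
    by (simp add: mpow_def abs_prod power_abs)
  also have "\<dots> \<le> (\<Prod>i\<in>UNIV. d ^ m i)"
    using assms by (intro prod_mono conjI power_mono) (auto simp: cube_def)
  finally show ?thesis
    by (simp add: power_sum)
qed

lemma series_on_cube_weaken:
  "\<lbrakk>series_on_cube x d f S; S \<le> T\<rbrakk> \<Longrightarrow> series_on_cube x d f T"
  unfolding series_on_cube_def by (meson order_trans)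

text \<open>Allowing monomials to repeat along an arbitrary index type lets products and infinite sums of
  series be treated by iterated summation, without an explicit convolution of coefficients.\<close>

lemma series_on_cube_indexed:
  fixes a :: "'i \<Rightarrow> real" and \<mu> :: "'i \<Rightarrow> 'n::finite \<Rightarrow> nat"
  assumes d: "d > 0"
    and a: "((\<lambda>i. \<bar>a i\<bar> * d ^ sum (\<mu> i) UNIV) has_sum S) UNIV"
    and f: "\<And>y. y \<in> cube x d \<Longrightarrow> ((\<lambda>i. a i * mpow (y - x) (\<mu> i)) has_sum f y) UNIV"
  shows "series_on_cube x d f S"
proof -
  \<comment> \<open>The indices are sorted into the fibres of \<open>\<mu>\<close>; the coefficient
    of a monomial is the sum of \<open>a\<close> over its fibre, on which the weight is
    constant.\<close>
  define F where "F m = {i. \<mu> i = m}" for m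
  define c where "c m = infsum a (F m)" for m
  have bij: "bij_betw snd (Sigma UNIV F) UNIV"
    by (rule bij_betwI[of _ _ _ "\<lambda>i. (\<mu> i, i)"]) (auto simp: F_def)
  have fib: "(\<lambda>i. \<bar>a i\<bar>) summable_on F m" for m
  proof -
    have "(\<lambda>i. \<bar>a i\<bar> * d ^ sum (\<mu> i) UNIV) summable_on F m"
      using a summable_on_subset_banach has_sum_imp_summable by blast
    also have "?this \<longleftrightarrow> (\<lambda>i. \<bar>a i\<bar> * d ^ sum m UNIV) summable_on F m"
      by (rule summable_on_cong) (simp add: F_def)
    finally show ?thesis
      using d by (subst (asm) summable_on_cmult_left') auto
  qed
  have fib': "(a has_sum c m) (F m)" for m
    unfolding c_def using fib[of m]
    by (simp add: summable_on_iff_abs_summable_on_real[of a])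
  have main: "((\<lambda>m. c m * mpow (y - x) m) has_sum f y) UNIV" if "y \<in> cube x d" for y
  proof (rule has_sum_Sigma'[where f = "\<lambda>(m, i). a i * mpow (y - x) (\<mu> i)" and B = F])
    show "((\<lambda>(m, i). a i * mpow (y - x) (\<mu> i)) has_sum f y) (Sigma UNIV F)"
      using f[OF that] has_sum_reindex_bij_betw[OF bij, of "\<lambda>i. a i * mpow (y - x) (\<mu> i)" "f y"]
      by (simp add: case_prod_unfold)
    fix m
    have "((\<lambda>i. a i * mpow (y - x) m) has_sum c m * mpow (y - x) m) (F m)"
      by (rule has_sum_cmult_left) (rule fib')
    then show "((\<lambda>i. case (m, i) of (m, i) \<Rightarrow> a i * mpow (y - x) (\<mu> i)) has_sum c m * mpow (y - x) m) (F m)"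
      by (rule has_sum_cong[THEN iffD1, rotated]) (simp add: F_def)
  qed
  have nrm: "((\<lambda>m. (infsum (\<lambda>i. \<bar>a i\<bar>) (F m)) * d ^ sum m UNIV) has_sum S) UNIV"
  proof (rule has_sum_Sigma'[where f = "\<lambda>(m, i). \<bar>a i\<bar> * d ^ sum (\<mu> i) UNIV" and B = F])
    show "((\<lambda>(m, i). \<bar>a i\<bar> * d ^ sum (\<mu> i) UNIV) has_sum S) (Sigma UNIV F)"
      using a has_sum_reindex_bij_betw[OF bij, of "\<lambda>i. \<bar>a i\<bar> * d ^ sum (\<mu> i) UNIV" S]
      by (simp add: case_prod_unfold)
    fix m
    have "((\<lambda>i. \<bar>a i\<bar> * d ^ sum m UNIV) has_sum infsum (\<lambda>i. \<bar>a i\<bar>) (F m) * d ^ sum m UNIV) (F m)"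
      by (rule has_sum_cmult_left) (simp add: fib)
    then show "((\<lambda>i. case (m, i) of (m, i) \<Rightarrow> \<bar>a i\<bar> * d ^ sum (\<mu> i) UNIV)
        has_sum infsum (\<lambda>i. \<bar>a i\<bar>) (F m) * d ^ sum m UNIV) (F m)"
      by (rule has_sum_cong[THEN iffD1, rotated]) (simp add: F_def)
  qed
  \<comment> \<open>Cancellation within a fibre can only lower the norm; this yields
    \<open>T \<le> S\<close>.\<close>
  have le: "\<bar>c m\<bar> * d ^ sum m UNIV \<le> infsum (\<lambda>i. \<bar>a i\<bar>) (F m) * d ^ sum m UNIV" for m
    using norm_infsum_bound[of a "F m"] fib[of m] d
    by (intro mult_right_mono) (auto simp: c_def)
  have "(\<lambda>m. \<bar>c m\<bar> * d ^ sum m UNIV) summable_on UNIV"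
    by (rule summable_on_comparison_test[OF has_sum_imp_summable[OF nrm]]) (use le d in auto)
  then obtain T where T: "((\<lambda>m. \<bar>c m\<bar> * d ^ sum m UNIV) has_sum T) UNIV"
    by (auto simp: summable_on_def)
  moreover have "T \<le> S"
    using has_sum_mono[OF T nrm] le by blast
  ultimately show ?thesis
    using main unfolding series_on_cube_def by blast
qed

text \<open>Completeness: the bounds make the double series over pairs \<open>(k, m)\<close>
  absolutely convergent, so it may be summed in either order. Summing over \<open>m\<close> first
  identifies the value as \<open>F y\<close>; grouping by \<open>m\<close> instead gives a power
  series.\<close>

lemma series_on_cube_sum:
  fixes f :: "'k \<Rightarrow> real^'n \<Rightarrow> real"
  assumes d: "d > 0" and f: "\<And>k. series_on_cube x d (f k) (S k)"
    and S: "S summable_on UNIV"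
    and F: "\<And>y. y \<in> cube x d \<Longrightarrow> ((\<lambda>k. f k y) has_sum F y) UNIV"
  shows "series_on_cube x d F (infsum S UNIV)"
proof -
  define P where "P k c T \<longleftrightarrow> ((\<lambda>m. \<bar>c m\<bar> * d ^ sum m UNIV) has_sum T) UNIV \<and> T \<le> S k \<and>
      (\<forall>y\<in>cube x d. ((\<lambda>m. c m * mpow (y - x) m) has_sum f k y) UNIV)" for k c T
  have "\<exists>c T. P k c T" for k
    using f[of k] unfolding series_on_cube_def P_def .
  then obtain c T where "\<And>k. P k (c k) (T k)"
    by metis
  then have T: "\<And>k. ((\<lambda>m. \<bar>c k m\<bar> * d ^ sum m UNIV) has_sum T k) UNIV"
    and TS: "\<And>k. T k \<le> S k"
    and c: "\<And>k y. y \<in> cube x d \<Longrightarrow> ((\<lambda>m. c k m * mpow (y - x) m) has_sum f k y) UNIV"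
    unfolding P_def by blast+
  have T0: "T k \<ge> 0" for k
    by (rule has_sum_nonneg[OF T]) (use d in auto)
  have Ts: "T summable_on UNIV"
    by (rule summable_on_comparison_test[OF S]) (use TS T0 in auto)
  let ?n = "\<lambda>(k, m). \<bar>c k m\<bar> * d ^ sum m UNIV"
  have ns: "?n summable_on Sigma UNIV (\<lambda>_. UNIV)"
    by (rule summable_on_SigmaI[where g = T]) (use T Ts d in auto)
  then obtain V where V: "(?n has_sum V) (Sigma UNIV (\<lambda>_. UNIV))"
    by (auto simp: summable_on_def)
  have VT: "(T has_sum V) UNIV"
    by (rule has_sum_Sigma'[OF V]) (use T in auto)
  have VS: "V \<le> infsum S UNIV"
    using has_sum_mono[OF VT has_sum_infsum[OF S]] TS by blast
  have fy: "((\<lambda>(k, m). c k m * mpow (y - x) m) has_sum F y) UNIV" if y: "y \<in> cube x d" for y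
  proof -
    have "(\<lambda>p. norm (case p of (k, m) \<Rightarrow> c k m * mpow (y - x) m)) summable_on Sigma UNIV (\<lambda>_. UNIV)"
      by (rule Infinite_Sum.abs_summable_on_comparison_test'[OF ns])
         (auto simp: abs_mult intro!: mult_left_mono abs_mpow_le y)
    then have "(\<lambda>(k, m). c k m * mpow (y - x) m) summable_on Sigma UNIV (\<lambda>_. UNIV)"
      by (rule abs_summable_summable)
    then obtain v where v: "((\<lambda>(k, m). c k m * mpow (y - x) m) has_sum v) (Sigma UNIV (\<lambda>_. UNIV))"
      by (auto simp: summable_on_def)
    have "((\<lambda>k. f k y) has_sum v) UNIV"
      by (rule has_sum_Sigma'[OF v]) (use c y in auto)
    then have "v = F y"
      using F[OF y] has_sum_unique by blast
    with v show ?thesis by simp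
  qed
  have "series_on_cube x d F V"
    by (rule series_on_cube_indexed[where a = "\<lambda>(k, m). c k m" and \<mu> = snd])
       (use d V fy in \<open>auto simp: case_prod_unfold\<close>)
  then show ?thesis
    using VS by (rule series_on_cube_weaken)
qed

lemma series_on_cube_add:
  assumes "series_on_cube x d f S" "series_on_cube x d g T" "d > 0"
  shows "series_on_cube x d (\<lambda>y. f y + g y) (S + T)"
proof -
  obtain a A where a: "((\<lambda>m. \<bar>a m\<bar> * d ^ sum m UNIV) has_sum A) UNIV" "A \<le> S"
    "\<And>y. y \<in> cube x d \<Longrightarrow> ((\<lambda>m. a m * mpow (y - x) m) has_sum f y) UNIV"
    using assms(1) unfolding series_on_cube_def by blast
  obtain b B where b: "((\<lambda>m. \<bar>b m\<bar> * d ^ sum m UNIV) has_sum B) UNIV" "B \<le> T"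
    "\<And>y. y \<in> cube x d \<Longrightarrow> ((\<lambda>m. b m * mpow (y - x) m) has_sum g y) UNIV"
    using assms(2) unfolding series_on_cube_def by blast
  have le: "\<bar>a m + b m\<bar> * d ^ sum m UNIV \<le> \<bar>a m\<bar> * d ^ sum m UNIV + \<bar>b m\<bar> * d ^ sum m UNIV" for m
    unfolding distrib_right[symmetric] using assms(3) by (intro mult_right_mono) auto
  have "(\<lambda>m. \<bar>a m + b m\<bar> * d ^ sum m UNIV) summable_on UNIV"
    by (rule summable_on_comparison_test[OF has_sum_imp_summable[OF has_sum_add[OF a(1) b(1)]]])
       (use le assms(3) in auto)
  then obtain C where C: "((\<lambda>m. \<bar>a m + b m\<bar> * d ^ sum m UNIV) has_sum C) UNIV"
    by (auto simp: summable_on_def)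
  moreover have "C \<le> S + T"
    using has_sum_mono[OF C has_sum_add[OF a(1) b(1)]] le a(2) b(2) by fastforce
  moreover have "((\<lambda>m. (a m + b m) * mpow (y - x) m) has_sum f y + g y) UNIV" if "y \<in> cube x d" for y
    using has_sum_add[OF a(3)[OF that] b(3)[OF that]] by (simp add: distrib_right)
  ultimately show ?thesis
    unfolding series_on_cube_def by (intro exI[of _ "\<lambda>m. a m + b m"] exI[of _ C]) auto
qed

lemma series_on_cube_monomial_mult:
  assumes "series_on_cube x d f S" "d > 0"
  shows "series_on_cube x d (\<lambda>y. a * mpow (y - x) k * f y) (\<bar>a\<bar> * d ^ sum k UNIV * S)"
proof -
  obtain c T where c: "((\<lambda>m. \<bar>c m\<bar> * d ^ sum m UNIV) has_sum T) UNIV" "T \<le> S"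
    "\<And>y. y \<in> cube x d \<Longrightarrow> ((\<lambda>m. c m * mpow (y - x) m) has_sum f y) UNIV"
    using assms(1) unfolding series_on_cube_def by blast
  have "series_on_cube x d (\<lambda>y. a * mpow (y - x) k * f y) (\<bar>a\<bar> * d ^ sum k UNIV * T)"
  proof (rule series_on_cube_indexed[where a = "\<lambda>m. a * c m" and \<mu> = "\<lambda>m i. k i + m i"])
    show "((\<lambda>i. \<bar>a * c i\<bar> * d ^ (\<Sum>ia\<in>UNIV. k ia + i ia)) has_sum \<bar>a\<bar> * d ^ sum k UNIV * T) UNIV"
      using has_sum_cmult_right[OF c(1), of "\<bar>a\<bar> * d ^ sum k UNIV"]
      by (simp add: abs_mult sum.distrib power_add algebra_simps)
    show "((\<lambda>i. a * c i * mpow (y - x) (\<lambda>ia. k ia + i ia)) has_sum a * mpow (y - x) k * f y) UNIV"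
      if "y \<in> cube x d" for y
      using has_sum_cmult_right[OF c(3)[OF that], of "a * mpow (y - x) k"]
      by (simp add: mpow_add algebra_simps)
  qed (use assms in auto)
  moreover have "\<bar>a\<bar> * d ^ sum k UNIV * T \<le> \<bar>a\<bar> * d ^ sum k UNIV * S"
    using c(2) assms(2) by (intro mult_left_mono) auto
  ultimately show ?thesis
    by (rule series_on_cube_weaken)
qed

text \<open>The coefficient norm dominates the supremum on the cube. In compositions this keeps the
  inner function within the radius of convergence of the outer series.\<close>

lemma series_on_cube_bound:
  assumes "series_on_cube x d f S" "y \<in> cube x d"
  shows "\<bar>f y\<bar> \<le> S"
proof -
  obtain c T where c: "((\<lambda>m. \<bar>c m\<bar> * d ^ sum m UNIV) has_sum T) UNIV" "T \<le> S"
    "((\<lambda>m. c m * mpow (y - x) m) has_sum f y) UNIV"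
    using assms unfolding series_on_cube_def by blast
  have le: "\<bar>c m * mpow (y - x) m\<bar> \<le> \<bar>c m\<bar> * d ^ sum m UNIV" for m
    using abs_mpow_le[OF assms(2)] by (auto simp: abs_mult intro!: mult_left_mono)
  have "f y \<le> T"
    by (rule has_sum_mono[OF c(3) c(1)]) (use le in \<open>auto simp: abs_le_iff\<close>)
  moreover have "((\<lambda>m. - (c m * mpow (y - x) m)) has_sum - f y) UNIV"
    using c(3) by (simp add: has_sum_uminus)
  then have "- f y \<le> T"
    by (rule has_sum_mono[OF _ c(1)]) (use le in \<open>auto simp: abs_le_iff\<close>)
  ultimately show ?thesis using c(2) by linarith
qed

lemma series_on_cube_nonneg: "series_on_cube x d f S \<Longrightarrow> d > 0 \<Longrightarrow> S \<ge> 0"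
  using series_on_cube_bound[of x d f S x] by (auto simp: cube_def)

text \<open>Only the first factor is expanded. Each of its terms times \<open>g\<close> merely
  shifts exponents, and the resulting series are added by \<open>series_on_cube_sum\<close>.\<close>

lemma series_on_cube_mult:
  assumes "series_on_cube x d f S" "series_on_cube x d g T" "d > 0"
  shows "series_on_cube x d (\<lambda>y. f y * g y) (S * T)"
proof -
  obtain a A where a: "((\<lambda>m. \<bar>a m\<bar> * d ^ sum m UNIV) has_sum A) UNIV" "A \<le> S"
    "\<And>y. y \<in> cube x d \<Longrightarrow> ((\<lambda>m. a m * mpow (y - x) m) has_sum f y) UNIV"
    using assms(1) unfolding series_on_cube_def by blast
  have AT: "((\<lambda>m. \<bar>a m\<bar> * d ^ sum m UNIV * T) has_sum A * T) UNIV"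
    by (rule has_sum_cmult_left[OF a(1)])
  have "series_on_cube x d (\<lambda>y. f y * g y) (infsum (\<lambda>m. \<bar>a m\<bar> * d ^ sum m UNIV * T) UNIV)"
    by (rule series_on_cube_sum[OF assms(3) series_on_cube_monomial_mult[OF assms(2,3)]
          has_sum_imp_summable[OF AT]])
       (rule has_sum_cmult_left[OF a(3)])
  moreover have "A * T \<le> S * T"
    using a(2) series_on_cube_nonneg[OF assms(2,3)] by (rule mult_right_mono)
  ultimately show ?thesis
    unfolding infsumI[OF AT] by (rule series_on_cube_weaken)
qed

lemma has_sum_single:
  fixes f :: "'a \<Rightarrow> real"
  assumes "\<And>j. j \<noteq> i \<Longrightarrow> f j = 0"
  shows "(f has_sum f i) UNIV"
proof -
  have "(f has_sum f i) {i}"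
    by (rule has_sum_finiteI) auto
  also have "?this \<longleftrightarrow> (f has_sum f i) UNIV"
    by (rule has_sum_cong_neutral) (use assms in auto)
  finally show ?thesis .
qed

lemma series_on_cube_monomial:
  assumes "d > 0"
  shows "series_on_cube x d (\<lambda>y. a * mpow (y - x) k) (\<bar>a\<bar> * d ^ sum k UNIV)"
  \<comment> \<open>A series with one term, indexed by \<open>unit\<close>.\<close>
  by (rule series_on_cube_indexed[where a = "\<lambda>_::unit. a" and \<mu> = "\<lambda>_. k", OF assms])
     (auto intro!: has_sum_finiteI)

lemma series_on_cube_const:
  assumes "d > 0"
  shows "series_on_cube x d (\<lambda>y. a) \<bar>a\<bar>"
  using series_on_cube_monomial[OF assms, of x a "\<lambda>_. 0"] by (simp add: mpow_def)

lemma series_on_cube_coordinate: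
  assumes "d > 0"
  shows "series_on_cube x d (\<lambda>y. y $ i - x $ i) d"
proof -
  have "mpow h (\<lambda>j. if j = i then 1 else 0) = h $ i" for h
    unfolding mpow_def by (simp add: if_distrib[of "power _"] prod.delta cong: if_cong)
  then show ?thesis
    using series_on_cube_monomial[OF assms, of x 1 "\<lambda>j. if j = i then 1 else 0"] by simp
qed

lemma series_on_cube_power:
  assumes "series_on_cube x d f S" "d > 0"
  shows "series_on_cube x d (\<lambda>y. f y ^ n) (S ^ n)"
proof (induction n)
  case 0
  then show ?case using series_on_cube_const[OF assms(2), of x 1] by simp
next
  case (Suc n)
  then show ?case using series_on_cube_mult[OF assms(1) Suc assms(2)] by simp
qed

lemma cube_mono: "d' \<le> d \<Longrightarrow> cube x d' \<subseteq> cube x d"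
  by (auto simp: cube_def intro: order_trans)

lemma series_on_cube_mono:
  assumes "series_on_cube x d f S" "0 < d'" "d' \<le> d"
  shows "series_on_cube x d' f S"
proof -
  obtain c T where c: "((\<lambda>m. \<bar>c m\<bar> * d ^ sum m UNIV) has_sum T) UNIV" "T \<le> S"
    "\<And>y. y \<in> cube x d \<Longrightarrow> ((\<lambda>m. c m * mpow (y - x) m) has_sum f y) UNIV"
    using assms(1) unfolding series_on_cube_def by blast
  have le: "\<bar>c m\<bar> * d' ^ sum m UNIV \<le> \<bar>c m\<bar> * d ^ sum m UNIV" for m
    using assms by (intro mult_left_mono power_mono) auto
  have "(\<lambda>m. \<bar>c m\<bar> * d' ^ sum m UNIV) summable_on UNIV"
    by (rule summable_on_comparison_test[OF has_sum_imp_summable[OF c(1)]]) (use le assms in auto)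
  then obtain C where C: "((\<lambda>m. \<bar>c m\<bar> * d' ^ sum m UNIV) has_sum C) UNIV"
    by (auto simp: summable_on_def)
  have "C \<le> S"
    using has_sum_mono[OF C c(1)] le c(2) by fastforce
  then show ?thesis
    using C c(3) cube_mono[OF assms(3), of x] unfolding series_on_cube_def by blast
qed

text \<open>Shrinking the cube by a factor \<open>t \<le> 1\<close> multiplies the weight of every
  nonconstant monomial by at most \<open>t\<close>, and subtracting \<open>f x\<close> removes the
  constant one. The norm is therefore at most \<open>t * S\<close>.\<close>

lemma series_on_cube_shrink:
  assumes f: "series_on_cube x d f S" and d: "d > 0" and e: "e > 0"
  shows "\<exists>d'. 0 < d' \<and> d' \<le> d \<and> series_on_cube x d' (\<lambda>y. f y - f x) e"
proof -
  have S: "S \<ge> 0" using series_on_cube_nonneg[OF f d] .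
  obtain c T where c: "((\<lambda>m. \<bar>c m\<bar> * d ^ sum m UNIV) has_sum T) UNIV" "T \<le> S"
    "\<And>y. y \<in> cube x d \<Longrightarrow> ((\<lambda>m. c m * mpow (y - x) m) has_sum f y) UNIV"
    using f unfolding series_on_cube_def by blast
  \<comment> \<open>The minimum with \<open>1\<close> ensures that powers of \<open>t\<close> with
    positive exponent are at most \<open>t\<close>; the summand \<open>1\<close> in the denominator
    keeps the quotient meaningful when \<open>S = 0\<close>.\<close>
  define t where "t = min 1 (e / (S + 1))"
  have t: "0 < t" "t \<le> 1" "t * S \<le> e"
  proof -
    have "t * S \<le> (e / (S + 1)) * S"
      using S by (intro mult_right_mono) (auto simp: t_def)
    also have "\<dots> \<le> e" using S e by (simp add: field_simps)
    finally show "t * S \<le> e" .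
  qed (use S e in \<open>auto simp: t_def\<close>)
  define b where "b m = (if m = (\<lambda>_. 0) then 0 else c m)" for m
  \<comment> \<open>With \<open>0 ^ 0 = 1\<close> only the constant monomial survives at the centre,
    so \<open>f x\<close> is the constant coefficient.\<close>
  have mpow0: "mpow 0 m = (if m = (\<lambda>_. 0) then 1 else 0)" for m :: "'a \<Rightarrow> nat"
    by (auto simp: mpow_def power_0_left fun_eq_iff)
  have fx: "f x = c (\<lambda>_. 0)"
  proof (rule has_sum_unique)
    show "((\<lambda>m. c m * mpow (x - x) m) has_sum f x) UNIV"
      using c(3)[of x] d by (simp add: cube_def)
    show "((\<lambda>m. c m * mpow (x - x) m) has_sum c (\<lambda>_. 0)) UNIV"
      using has_sum_single[of "\<lambda>_. 0" "\<lambda>m. c m * mpow (x - x) m"] by (simp add: mpow0)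
  qed
  have le: "\<bar>b m\<bar> * (t * d) ^ sum m UNIV \<le> t * (\<bar>c m\<bar> * d ^ sum m UNIV)" for m
  proof (cases "m = (\<lambda>_. 0)")
    case False
    then have "sum m UNIV \<noteq> 0" by (auto simp: fun_eq_iff)
    then have "1 \<le> sum m UNIV" by linarith
    then have "t ^ sum m UNIV \<le> t ^ 1"
      by (rule power_decreasing) (use t in auto)
    then have "t ^ sum m UNIV \<le> t" by simp
    then have "t ^ sum m UNIV * (\<bar>c m\<bar> * d ^ sum m UNIV) \<le> t * (\<bar>c m\<bar> * d ^ sum m UNIV)"
      using d by (intro mult_right_mono) auto
    with False show ?thesis by (simp add: b_def power_mult_distrib algebra_simps)
  qed (use t in \<open>auto simp: b_def\<close>)
  have "(\<lambda>m. \<bar>b m\<bar> * (t * d) ^ sum m UNIV) summable_on UNIV"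
    by (rule summable_on_comparison_test[OF has_sum_imp_summable[OF has_sum_cmult_right[OF c(1), of t]]])
       (use le t d in auto)
  then obtain C where C: "((\<lambda>m. \<bar>b m\<bar> * (t * d) ^ sum m UNIV) has_sum C) UNIV"
    by (auto simp: summable_on_def)
  have "C \<le> t * T"
    using has_sum_mono[OF C has_sum_cmult_right[OF c(1)]] le by blast
  also have "\<dots> \<le> e"
    using mult_left_mono[OF c(2), of t] t by linarith
  finally have "C \<le> e" .
  moreover have "t * d \<le> d" using t d by simp
  moreover have "((\<lambda>m. b m * mpow (y - x) m) has_sum f y - f x) UNIV" if "y \<in> cube x (t * d)" for y
  proof -
    have "y \<in> cube x d" using that cube_mono[OF \<open>t * d \<le> d\<close>] by blast
    from c(3)[OF this]
    have 1: "((\<lambda>m. c m * mpow (y - x) m) has_sum f y) UNIV" .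
    have 2: "((\<lambda>m. if m = (\<lambda>_. 0) then c m else 0) has_sum f x) UNIV"
      using has_sum_single[of "\<lambda>_. 0" "\<lambda>m. if m = (\<lambda>_. 0) then c m else 0"] by (simp add: fx)
    have "((\<lambda>m. - (if m = (\<lambda>_. 0) then c m else 0)) has_sum - f x) UNIV"
      using 2 unfolding has_sum_uminus by simp
    from has_sum_add[OF 1 this]
    have "((\<lambda>m. c m * mpow (y - x) m - (if m = (\<lambda>_. 0) then c m else 0)) has_sum f y - f x) UNIV"
      by (simp only: diff_conv_add_uminus)
    then show ?thesis
      by (rule has_sum_cong[THEN iffD1, rotated]) (auto simp: b_def mpow_def)
  qed
  ultimately show ?thesis
    using t d C unfolding series_on_cube_def by (intro exI[of _ "t * d"]) auto
qed

text \<open>The outer series is evaluated at \<open>f y - f x\<close>, whose norm is at most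
  \<open>e < K\<close> on a small cube. Its terms then have norm at most
  \<open>\<bar>a n\<bar> * e ^ n\<close>, which is summable.\<close>

lemma series_on_cube_compose:
  assumes f: "series_on_cube x d f S" and d: "d > 0" and K: "K > 0"
    and h: "\<And>t. \<bar>t\<bar> < K \<Longrightarrow> (\<lambda>n. a n * t ^ n) sums h (f x + t)"
  shows "\<exists>d'>0. \<exists>T. series_on_cube x d' (\<lambda>y. h (f y)) T"
proof -
  obtain e where e: "0 < e" "e < K"
    using K dense by blast
  obtain d' where d': "0 < d'" "series_on_cube x d' (\<lambda>y. f y - f x) e"
    using series_on_cube_shrink[OF f d e(1)] by blast
  \<comment> \<open>Convergence at a point \<open>e'\<close> strictly beyond \<open>e\<close> gives
    absolute convergence at radius \<open>e\<close>.\<close>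
  obtain e' where e': "e < e'" "e' < K"
    using e dense by blast
  have abs_conv: "summable (\<lambda>n. norm (a n * t ^ n))" if "\<bar>t\<bar> \<le> e" for t
    by (rule powser_insidea[of _ e']) (use h[of e'] e e' that in \<open>auto simp: sums_iff\<close>)
  have "series_on_cube x d' (\<lambda>y. h (f y)) (infsum (\<lambda>n. \<bar>a n\<bar> * e ^ n) UNIV)"
  proof (rule series_on_cube_sum[where f = "\<lambda>n y. a n * (f y - f x) ^ n"])
    show "series_on_cube x d' (\<lambda>y. a n * (f y - f x) ^ n) (\<bar>a n\<bar> * e ^ n)" for n
      by (intro series_on_cube_mult series_on_cube_const series_on_cube_power d')
    show "(\<lambda>n. \<bar>a n\<bar> * e ^ n) summable_on UNIV"
      using abs_conv[of e] e by (subst summable_on_UNIV_nonneg_real_iff) (auto simp: abs_mult power_abs)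
    fix y assume "y \<in> cube x d'"
    then have "\<bar>f y - f x\<bar> \<le> e"
      using series_on_cube_bound[OF d'(2)] by blast
    then show "((\<lambda>n. a n * (f y - f x) ^ n) has_sum h (f y)) UNIV"
      using h[of "f y - f x"] e abs_conv by (intro norm_summable_imp_has_sum) auto
  qed (use d' in auto)
  with d' show ?thesis by blast
qed

section \<open>Closure properties of analytic and elementary functions\<close>

definition analytic_at :: "(real^'n \<Rightarrow> real) \<Rightarrow> real^'n \<Rightarrow> bool" where
  "analytic_at f x \<longleftrightarrow> (\<exists>d>0. \<exists>S. series_on_cube x d f S)"

lemma analytic_atI: "0 < d \<Longrightarrow> series_on_cube x d f S \<Longrightarrow> analytic_at f x"
  unfolding analytic_at_def by blast

lemma real_analytic_onI:
  assumes "\<And>x. x \<in> U \<Longrightarrow> analytic_at f x"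
  shows "real_analytic_on f U"
  unfolding real_analytic_on_def
proof
  fix x assume "x \<in> U"
  then obtain d S where d: "d > 0" and "series_on_cube x d f S"
    using assms unfolding analytic_at_def by blast
  then obtain c where c: "\<And>y. y \<in> cube x d \<Longrightarrow> ((\<lambda>m. c m * mpow (y - x) m) has_sum f y) UNIV"
    unfolding series_on_cube_def by blast
  have "ball x d \<subseteq> cube x d"
  proof
    fix y assume "y \<in> ball x d"
    then have "norm (y - x) < d"
      by (simp add: dist_norm norm_minus_commute)
    moreover have "\<bar>y $ i - x $ i\<bar> \<le> norm (y - x)" for i
      using component_le_norm_cart[of "y - x" i] by simp
    ultimately have "\<bar>y $ i - x $ i\<bar> \<le> d" for i
      by (meson less_imp_le order_trans)
    then show "y \<in> cube x d"
      by (simp add: cube_def)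
  qed
  then have "\<forall>y\<in>ball x d. ((\<lambda>m. c m * (\<Prod>i\<in>UNIV. (y$i - x$i) ^ m i)) has_sum f y) UNIV"
    using c unfolding mpow_def vector_minus_component by blast
  with d show "\<exists>r>0. \<exists>c. \<forall>y\<in>ball x r.
      ((\<lambda>m. c m * (\<Prod>i\<in>UNIV. (y$i - x$i) ^ m i)) has_sum f y) UNIV"
    by blast
qed

lemma analytic_at_const: "analytic_at (\<lambda>y. a) x"
  by (rule analytic_atI[OF zero_less_one series_on_cube_const]) simp

lemma analytic_at_common:
  assumes "analytic_at f x" "analytic_at g x"
  obtains d S T where "d > 0" "series_on_cube x d f S" "series_on_cube x d g T"
proof -
  obtain d S d' T where "d > 0" "series_on_cube x d f S" "d' > 0" "series_on_cube x d' g T"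
    using assms unfolding analytic_at_def by blast
  then show ?thesis
    using that[of "min d d'" S T] series_on_cube_mono[of x d f S "min d d'"]
      series_on_cube_mono[of x d' g T "min d d'"] by simp
qed

lemma analytic_at_add: "analytic_at f x \<Longrightarrow> analytic_at g x \<Longrightarrow> analytic_at (\<lambda>y. f y + g y) x"
  by (erule (1) analytic_at_common) (rule analytic_atI, assumption, rule series_on_cube_add)

lemma analytic_at_mult: "analytic_at f x \<Longrightarrow> analytic_at g x \<Longrightarrow> analytic_at (\<lambda>y. f y * g y) x"
  by (erule (1) analytic_at_common) (rule analytic_atI, assumption, rule series_on_cube_mult)

lemma analytic_at_coordinate: "analytic_at (\<lambda>y. y $ i) x"
proof -
  have "analytic_at (\<lambda>y. y $ i - x $ i) x"
    by (rule analytic_atI[OF zero_less_one series_on_cube_coordinate]) simp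
  from analytic_at_add[OF this analytic_at_const[of "x $ i"]] show ?thesis by simp
qed

lemma analytic_at_compose:
  assumes f: "analytic_at f x" and h: "K > 0" "\<And>t. \<bar>t\<bar> < K \<Longrightarrow> (\<lambda>n. a n * t ^ n) sums h (f x + t)"
  shows "analytic_at (\<lambda>y. h (f y)) x"
proof -
  obtain d S where "d > 0" "series_on_cube x d f S"
    using f unfolding analytic_at_def by blast
  from series_on_cube_compose[OF this(2,1) h(1), of a h] h(2)
  have "\<exists>d'>0. \<exists>T. series_on_cube x d' (\<lambda>y. h (f y)) T" by simp
  then show ?thesis unfolding analytic_at_def .
qed

text \<open>The addition theorem turns the expansions at 0 into one at \<open>f x\<close>. They
  converge everywhere, so the radius \<open>1\<close> is an arbitrary choice.\<close>

lemma analytic_at_sin: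
  assumes "analytic_at f x"
  shows "analytic_at (\<lambda>y. sin (f y)) x"
proof (rule analytic_at_compose[OF assms, of 1])
  fix t :: real
  have "(\<lambda>n. sin (f x) * (cos_coeff n * t ^ n) + cos (f x) * (sin_coeff n * t ^ n)) sums
      (sin (f x) * cos t + cos (f x) * sin t)"
    using cos_converges[of t] sin_converges[of t] by (intro sums_add sums_mult) auto
  then show "(\<lambda>n. (sin (f x) * cos_coeff n + cos (f x) * sin_coeff n) * t ^ n) sums sin (f x + t)"
    by (simp add: sin_add algebra_simps)
qed simp

lemma analytic_at_cos:
  assumes "analytic_at f x"
  shows "analytic_at (\<lambda>y. cos (f y)) x"
proof (rule analytic_at_compose[OF assms, of 1])
  fix t :: real
  have "(\<lambda>n. cos (f x) * (cos_coeff n * t ^ n) - sin (f x) * (sin_coeff n * t ^ n)) sums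
      (cos (f x) * cos t - sin (f x) * sin t)"
    using cos_converges[of t] sin_converges[of t] by (intro sums_diff sums_mult) auto
  then show "(\<lambda>n. (cos (f x) * cos_coeff n - sin (f x) * sin_coeff n) * t ^ n) sums cos (f x + t)"
    by (simp add: cos_add algebra_simps)
qed simp

text \<open>Both properties are carried together so that one traversal of a formula establishes them
  at once.\<close>

definition analytic_elementary_on :: "(real^'n) set \<Rightarrow> (real^'n \<Rightarrow> real) \<Rightarrow> bool" where
  "analytic_elementary_on U f \<longleftrightarrow> (\<forall>x\<in>U. analytic_at f x) \<and> elementary_on U f"

lemma analytic_elementary_const: "analytic_elementary_on U (\<lambda>x. c)"
  by (simp add: analytic_elementary_on_def analytic_at_const elementary_on.const)

lemma analytic_elementary_coordinate: "analytic_elementary_on U (\<lambda>x. x $ i)"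
  by (simp add: analytic_elementary_on_def analytic_at_coordinate elementary_on.coordinate)

lemma analytic_elementary_add:
  "analytic_elementary_on U f \<Longrightarrow> analytic_elementary_on U g \<Longrightarrow> analytic_elementary_on U (\<lambda>x. f x + g x)"
  by (simp add: analytic_elementary_on_def analytic_at_add elementary_on.add)

lemma analytic_elementary_mult:
  "analytic_elementary_on U f \<Longrightarrow> analytic_elementary_on U g \<Longrightarrow> analytic_elementary_on U (\<lambda>x. f x * g x)"
  by (simp add: analytic_elementary_on_def analytic_at_mult elementary_on.mult)

lemma analytic_elementary_uminus:
  "analytic_elementary_on U f \<Longrightarrow> analytic_elementary_on U (\<lambda>x. - f x)"
  using analytic_elementary_mult[OF analytic_elementary_const[of U "-1"]] by simp

lemma analytic_elementary_diff:
  "analytic_elementary_on U f \<Longrightarrow> analytic_elementary_on U g \<Longrightarrow> analytic_elementary_on U (\<lambda>x. f x - g x)"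
  using analytic_elementary_add[OF _ analytic_elementary_uminus] by fastforce

lemma analytic_elementary_power:
  "analytic_elementary_on U f \<Longrightarrow> analytic_elementary_on U (\<lambda>x. f x ^ n)"
  by (induction n) (auto intro: analytic_elementary_const analytic_elementary_mult)

lemma analytic_elementary_sin:
  "analytic_elementary_on U f \<Longrightarrow> analytic_elementary_on U (\<lambda>x. sin (f x))"
  by (simp add: analytic_elementary_on_def analytic_at_sin elementary_on.sin)

lemma analytic_elementary_cos:
  "analytic_elementary_on U f \<Longrightarrow> analytic_elementary_on U (\<lambda>x. cos (f x))"
  by (simp add: analytic_elementary_on_def analytic_at_cos elementary_on.cos)

text \<open>The binomial series at \<open>f x\<close> has radius \<open>f x\<close> and stays among
  positive arguments, where \<open>h\<close> is a power. Reciprocals (\<open>e = -1\<close>) and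
  square roots (\<open>e = 1/2\<close>) are both instances.\<close>

lemma analytic_at_of_powr:
  assumes "analytic_at f x" "f x > 0" "\<And>t. t > 0 \<Longrightarrow> h t = t powr e"
  shows "analytic_at (\<lambda>y. h (f y)) x"
proof (rule analytic_at_compose[OF assms(1,2)])
  fix t assume t: "\<bar>t\<bar> < f x"
  then have "f x + t > 0" by linarith
  then show "(\<lambda>n. ((e gchoose n) * f x powr (e - real n)) * t ^ n) sums h (f x + t)"
    using gen_binomial_real''[OF t, of e] assms(3) by simp
qed

lemma analytic_elementary_divide:
  assumes "analytic_elementary_on U f" "analytic_elementary_on U g" "\<And>x. x \<in> U \<Longrightarrow> g x > 0"
  shows "analytic_elementary_on U (\<lambda>x. f x / g x)"
proof -
  have "analytic_at (\<lambda>y. inverse (g y)) x" if "x \<in> U" for x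
    by (rule analytic_at_of_powr[where e = "-1"])
       (use assms that in \<open>auto simp: analytic_elementary_on_def powr_minus\<close>)
  then have "analytic_at (\<lambda>y. f y * inverse (g y)) x" if "x \<in> U" for x
    using analytic_at_mult assms(1) that unfolding analytic_elementary_on_def by blast
  moreover have "elementary_on U (\<lambda>x. f x / g x)"
    using assms unfolding analytic_elementary_on_def
    by (intro elementary_on.divide) fastforce+
  ultimately show ?thesis
    by (simp add: analytic_elementary_on_def divide_inverse)
qed

lemma analytic_elementary_sqrt:
  assumes "analytic_elementary_on U f" "\<And>x. x \<in> U \<Longrightarrow> f x > 0"
  shows "analytic_elementary_on U (\<lambda>x. sqrt (f x))"
proof -
  have "analytic_at (\<lambda>y. sqrt (f y)) x" if "x \<in> U" for x
    by (rule analytic_at_of_powr[where e = "1/2"])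
       (use assms that in \<open>auto simp: analytic_elementary_on_def powr_half_sqrt\<close>)
  moreover have "elementary_on U (\<lambda>x. root 2 (f x))"
    using assms unfolding analytic_elementary_on_def
    by (intro elementary_on.root) (auto intro: less_imp_le)
  ultimately show ?thesis
    by (simp add: analytic_elementary_on_def sqrt_def)
qed

lemmas analytic_elementary_intros =
  analytic_elementary_const analytic_elementary_coordinate analytic_elementary_add
  analytic_elementary_mult analytic_elementary_uminus analytic_elementary_diff
  analytic_elementary_power analytic_elementary_divide
  analytic_elementary_sqrt analytic_elementary_sin analytic_elementary_cos

text \<open>For a unit complex direction the powers give cosine and sine of multiples of its angle
  as real polynomials in its components, without any branch of the angle.\<close>

lemma analytic_elementary_complex_power:
  fixes f :: "real^'n \<Rightarrow> complex"
  assumes "analytic_elementary_on U (\<lambda>x. Re (f x))" "analytic_elementary_on U (\<lambda>x. Im (f x))"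
  shows "analytic_elementary_on U (\<lambda>x. Re (f x ^ n)) \<and> analytic_elementary_on U (\<lambda>x. Im (f x ^ n))"
  by (induction n) (auto intro!: analytic_elementary_intros assms)

section \<open>The coframe of the torus knot\<close>

text \<open>Write \<open>\<phi>\<close> for the angle around the \<open>z\<close>-axis and \<open>\<theta>\<close> for the angle around the core circle
  (\<open>cos \<theta> = (axis_dist - 2) / sqrt core_dist2\<close>). Then \<open>d_long\<close> and \<open>d_mer\<close> are \<open>d\<phi>\<close> and \<open>d\<theta>\<close>,
  \<open>d_core\<close> is the gradient of the squared distance to the core circle, \<open>e_core\<close>, \<open>e_long\<close>, \<open>e_mer\<close>
  is the dual frame, and \<open>knot_phase p q = exp (\<i> (p \<phi> - q \<theta>))\<close>. The angles themselves are
  multivalued, so only their differentials and exponentials occur.\<close>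

definition axis_dist :: "real^3 \<Rightarrow> real" where
  "axis_dist x = sqrt ((x$1)\<^sup>2 + (x$2)\<^sup>2)"

definition core_dist2 :: "real^3 \<Rightarrow> real" where
  "core_dist2 x = (axis_dist x - 2)\<^sup>2 + (x$3)\<^sup>2"

definition d_core :: "real^3 \<Rightarrow> real^3" where
  "d_core x = vector [2 * (axis_dist x - 2) * x$1 / axis_dist x, 2 * (axis_dist x - 2) * x$2 / axis_dist x, 2 * x$3]"

definition d_long :: "real^3 \<Rightarrow> real^3" where
  "d_long x = vector [- x$2 / ((x$1)\<^sup>2 + (x$2)\<^sup>2), x$1 / ((x$1)\<^sup>2 + (x$2)\<^sup>2), 0]"

definition d_mer :: "real^3 \<Rightarrow> real^3" where
  "d_mer x = vector [- x$3 * x$1 / (axis_dist x * core_dist2 x), - x$3 * x$2 / (axis_dist x * core_dist2 x),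
     (axis_dist x - 2) / core_dist2 x]"

definition d_phase :: "nat \<Rightarrow> nat \<Rightarrow> real^3 \<Rightarrow> real^3" where
  "d_phase p q x = real p *\<^sub>R d_long x + (- real q) *\<^sub>R d_mer x"

definition long_dir :: "real^3 \<Rightarrow> complex" where
  "long_dir x = Complex (x$1 / axis_dist x) (x$2 / axis_dist x)"

text \<open>This is exp(- i theta); the conjugation lets \<open>knot_phase\<close> use the natural
  exponent \<open>q\<close>.\<close>

definition mer_dir :: "real^3 \<Rightarrow> complex" where
  "mer_dir x = Complex ((axis_dist x - 2) / sqrt (core_dist2 x)) (- x$3 / sqrt (core_dist2 x))"

definition knot_phase :: "nat \<Rightarrow> nat \<Rightarrow> real^3 \<Rightarrow> complex" where
  "knot_phase p q x = long_dir x ^ p * mer_dir x ^ q"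

definition knot_metric :: "nat \<Rightarrow> nat \<Rightarrow> real \<Rightarrow> metric_field" where
  "knot_metric p q l x = coframe_metric (d_core x) (d_phase p q x) (l *\<^sub>R d_long x)"

definition e_core :: "real^3 \<Rightarrow> real^3" where
  "e_core x = vector [(axis_dist x - 2) * x$1 / (2 * axis_dist x * core_dist2 x),
     (axis_dist x - 2) * x$2 / (2 * axis_dist x * core_dist2 x), x$3 / (2 * core_dist2 x)]"

definition e_long :: "real^3 \<Rightarrow> real^3" where
  "e_long x = vector [- x$2, x$1, 0]"

definition e_mer :: "real^3 \<Rightarrow> real^3" where
  "e_mer x = vector [- x$3 * x$1 / axis_dist x, - x$3 * x$2 / axis_dist x, axis_dist x - 2]"

text \<open>The vectors multiplied by the three coefficients form the frame dual to ds, du, dw. In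
  the last one the multiple of \<open>e_mer\<close> cancels the contribution p / l of
  \<open>e_long\<close> to du.\<close>

definition knot_field :: "nat \<Rightarrow> nat \<Rightarrow> real \<Rightarrow> vector_field" where
  "knot_field p q l x =
     Im (knot_phase p q x) *\<^sub>R e_core x
     + sin (core_dist2 x - 1) *\<^sub>R ((- 1 / real q) *\<^sub>R e_mer x)
     + (cos (core_dist2 x - 1) - Re (knot_phase p q x)) *\<^sub>R
         ((1 / l) *\<^sub>R e_long x + (real p / (l * real q)) *\<^sub>R e_mer x)"

lemma toroidal_annulus_iff: "x \<in> toroidal_annulus \<longleftrightarrow> 1/4 < core_dist2 x \<and> core_dist2 x < 9/4"
  by (simp add: toroidal_annulus_def core_dist2_def axis_dist_def)

lemma toroidal_annulus_pos:
  assumes "x \<in> toroidal_annulus"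
  shows "axis_dist x > 0" "core_dist2 x > 0" "(x$1)\<^sup>2 + (x$2)\<^sup>2 > 0"
proof -
  have "axis_dist x \<noteq> 0"
  proof
    assume "axis_dist x = 0"
    then have "core_dist2 x = 4 + (x$3)\<^sup>2" by (simp add: core_dist2_def)
    with assms show False
      using zero_le_power2[of "x$3"] unfolding toroidal_annulus_iff by linarith
  qed
  then show "axis_dist x > 0" by (simp add: axis_dist_def less_le)
  then show "(x$1)\<^sup>2 + (x$2)\<^sup>2 > 0" by (simp add: axis_dist_def)
  show "core_dist2 x > 0" using assms by (simp add: toroidal_annulus_iff)
qed

lemma axis_dist_sq: "(axis_dist x)\<^sup>2 = (x$1)\<^sup>2 + (x$2)\<^sup>2"
  by (simp add: axis_dist_def)

lemma open_toroidal_annulus: "open toroidal_annulus"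
proof -
  have "continuous_on UNIV core_dist2"
    unfolding core_dist2_def axis_dist_def by (intro continuous_intros)
  then have "open ({x. 1/4 < core_dist2 x} \<inter> {x. core_dist2 x < 9/4})"
    by (intro open_Int open_Collect_less continuous_intros)
  also have "{x. 1/4 < core_dist2 x} \<inter> {x. core_dist2 x < 9/4} = toroidal_annulus"
    by (auto simp: toroidal_annulus_iff)
  finally show ?thesis .
qed

lemma dual_frame:
  assumes "x \<in> toroidal_annulus"
  shows "d_core x \<bullet> e_core x = 1" "d_core x \<bullet> e_long x = 0" "d_core x \<bullet> e_mer x = 0"
    "d_long x \<bullet> e_core x = 0" "d_long x \<bullet> e_long x = 1" "d_long x \<bullet> e_mer x = 0"
    "d_mer x \<bullet> e_core x = 0" "d_mer x \<bullet> e_long x = 0" "d_mer x \<bullet> e_mer x = 1"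
proof -
  note pos = toroidal_annulus_pos[OF assms]
  \<comment> \<open>With these abbreviations all products are rational expressions; the relations
    between \<open>R\<close>, \<open>N\<close> and the coordinates enter only after denominators
    have been cleared.\<close>
  define R N where "R = axis_dist x" and "N = core_dist2 x"
  have R: "R > 0" "(x$1)\<^sup>2 = R\<^sup>2 - (x$2)\<^sup>2" using pos axis_dist_sq[of x] by (simp_all add: R_def)
  have N: "N > 0" "(x$3)\<^sup>2 = N - (R - 2)\<^sup>2" using pos by (simp_all add: N_def R_def core_dist2_def)
  note defs = d_core_def d_long_def d_mer_def e_core_def e_long_def e_mer_def inner_3 vector_3
    R_def[symmetric] N_def[symmetric]
  have "d_core x \<bullet> e_core x = ((R - 2)\<^sup>2 * ((x$1)\<^sup>2 + (x$2)\<^sup>2) / R\<^sup>2 + (x$3)\<^sup>2) / N"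
    unfolding defs using R(1) N(1) by (simp add: field_simps power2_eq_square)
  then show "d_core x \<bullet> e_core x = 1" using R N by simp
  have "d_core x \<bullet> e_mer x = 2 * (R - 2) * x$3 * (1 - ((x$1)\<^sup>2 + (x$2)\<^sup>2) / R\<^sup>2)"
    unfolding defs using R(1) N(1) by (simp add: field_simps power2_eq_square)
  then show "d_core x \<bullet> e_mer x = 0" using R by simp
  have "d_mer x \<bullet> e_core x = (R - 2) * x$3 * (1 - ((x$1)\<^sup>2 + (x$2)\<^sup>2) / R\<^sup>2) / (2 * N\<^sup>2)"
    unfolding defs using R(1) N(1) by (simp add: field_simps power2_eq_square)
  then show "d_mer x \<bullet> e_core x = 0" using R by simp
  have "d_mer x \<bullet> e_mer x = ((x$3)\<^sup>2 * ((x$1)\<^sup>2 + (x$2)\<^sup>2) / R\<^sup>2 + (R - 2)\<^sup>2) / N"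
    unfolding defs using R(1) N(1) by (simp add: field_simps power2_eq_square)
  then show "d_mer x \<bullet> e_mer x = 1" using R N by simp
  define S where "S = (x$1)\<^sup>2 + (x$2)\<^sup>2"
  have "d_long x \<bullet> e_long x = (x$1 * x$1 + x$2 * x$2) / S"
    unfolding defs S_def[symmetric] by (simp add: add_divide_distrib)
  also have "\<dots> = S / S"
    by (simp only: S_def power2_eq_square)
  finally show "d_long x \<bullet> e_long x = 1" using pos(3) by (simp add: S_def[symmetric])
qed (simp_all add: d_core_def d_long_def d_mer_def e_core_def e_long_def e_mer_def inner_3)

text \<open>Modulo the third row only \<open>- q * d_mer\<close> of the phase differential counts,
  and exchanging the last two rows absorbs the sign. The factor \<open>2 / axis_dist x\<close> is
  the determinant of \<open>d_core\<close>, \<open>d_long\<close>, \<open>d_mer\<close>, as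
  cylindrical and then polar coordinates show.\<close>

lemma det_coframe:
  assumes "x \<in> toroidal_annulus"
  shows "det (vector [d_core x, d_phase p q x, l *\<^sub>R d_long x] :: real^3^3) = 2 * real q * l / axis_dist x"
proof -
  note pos = toroidal_annulus_pos[OF assms]
  define R N m where "R = axis_dist x" and "N = core_dist2 x" and "m = axis_dist x - 2"
  have R: "R > 0" "(x$1)\<^sup>2 + (x$2)\<^sup>2 = R\<^sup>2" using pos axis_dist_sq[of x] by (simp_all add: R_def)
  have N: "N > 0" "m\<^sup>2 + (x$3)\<^sup>2 = N" using pos by (simp_all add: N_def m_def core_dist2_def)
  have d_long: "d_long x = vector [- x$2 / R\<^sup>2, x$1 / R\<^sup>2, 0]"
    by (simp add: d_long_def R(2))
  have "det (vector [d_core x, d_phase p q x, l *\<^sub>R d_long x] :: real^3^3) =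
      real q * l * (2 * (((x$1)\<^sup>2 + (x$2)\<^sup>2) * (m\<^sup>2 + (x$3)\<^sup>2)) / (R * R\<^sup>2 * N))"
    unfolding det_3 d_phase_def d_core_def d_long d_mer_def
      m_def[symmetric] unfolding R_def[symmetric] N_def[symmetric]
    by (simp add: divide_inverse algebra_simps power2_eq_square)
  then show ?thesis
    using R(1) N(1) unfolding R(2) N(2) by (simp add: R_def)
qed

text \<open>These are C_u, - C_s and C for C = cos s - cos u. Since the coframe is orthonormal, they
  are also the coefficients of the dual 1-form.\<close>

lemma coframe_knot_field:
  assumes "x \<in> toroidal_annulus" "q > 0" "l > 0"
  shows "d_core x \<bullet> knot_field p q l x = Im (knot_phase p q x)"
    "d_phase p q x \<bullet> knot_field p q l x = sin (core_dist2 x - 1)"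
    "(l *\<^sub>R d_long x) \<bullet> knot_field p q l x = cos (core_dist2 x - 1) - Re (knot_phase p q x)"
  using assms(2,3)
  by (simp_all add: knot_field_def d_phase_def inner_add_left inner_add_right inner_diff_left
      inner_diff_right dual_frame[OF assms(1)] field_simps)

section \<open>Differentials of the angles and the curl equation\<close>

lemma has_derivative_vec_nth: "((\<lambda>x. x $ i) has_derivative (\<lambda>v. v $ i)) F"
  by (rule bounded_linear_imp_has_derivative[OF bounded_linear_vec_nth])

lemma has_derivative_axis_dist:
  assumes "axis_dist x > 0"
  shows "(axis_dist has_derivative (\<lambda>v. (x$1 * v$1 + x$2 * v$2) / axis_dist x)) (at x)"
proof -
  have "(x$1)\<^sup>2 + (x$2)\<^sup>2 > 0" using assms by (simp add: axis_dist_def)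
  then show ?thesis
    unfolding axis_dist_def[abs_def]
    by (auto intro!: derivative_eq_intros has_derivative_vec_nth simp: fun_eq_iff field_simps)
       (simp add: add_divide_distrib)
qed

lemma has_derivative_core_dist2:
  assumes "axis_dist x > 0"
  shows "(core_dist2 has_derivative (\<lambda>v. d_core x \<bullet> v)) (at x)"
  unfolding core_dist2_def[abs_def] using assms
  by (auto intro!: derivative_eq_intros has_derivative_vec_nth has_derivative_axis_dist
      simp: d_core_def inner_3 fun_eq_iff field_simps)

text \<open>The quotient is the cosine of the angle of the point (f, g), and (f dg - g df) / (f^2 +
  g^2) is the differential of that angle; the formula is d cos = - sin times it.\<close>

lemma has_derivative_unit_component:
  fixes f g :: "real^3 \<Rightarrow> real"
  assumes "(f has_derivative f') (at x)" "(g has_derivative g') (at x)" "(f x)\<^sup>2 + (g x)\<^sup>2 > 0"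
  shows "((\<lambda>y. f y / sqrt ((f y)\<^sup>2 + (g y)\<^sup>2)) has_derivative
    (\<lambda>v. - (g x / sqrt ((f x)\<^sup>2 + (g x)\<^sup>2)) * ((f x * g' v - g x * f' v) / ((f x)\<^sup>2 + (g x)\<^sup>2)))) (at x)"
proof -
  define r where "r = sqrt ((f x)\<^sup>2 + (g x)\<^sup>2)"
  have r: "r > 0" "(f x)\<^sup>2 + (g x)\<^sup>2 = r\<^sup>2" using assms(3) by (simp_all add: r_def)
  have nz: "sqrt ((f x)\<^sup>2 + (g x)\<^sup>2) \<noteq> 0" using r(1) unfolding r_def by linarith
  have "((\<lambda>y. sqrt ((f y)\<^sup>2 + (g y)\<^sup>2)) has_derivative (\<lambda>v. (f x * f' v + g x * g' v) / r)) (at x)"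
    using assms(3) unfolding r_def
    by (auto intro!: derivative_eq_intros assms(1,2) simp: fun_eq_iff field_simps)
       (simp add: add_divide_distrib)
  from has_derivative_divide[OF assms(1) this nz]
  have "((\<lambda>y. f y / sqrt ((f y)\<^sup>2 + (g y)\<^sup>2)) has_derivative
      (\<lambda>v. - f x * (inverse r * ((f x * f' v + g x * g' v) / r) * inverse r) + f' v / r)) (at x)"
    unfolding r_def[symmetric] .
  moreover have "- f x * (inverse r * ((f x * a + g x * b) / r) * inverse r) + a / r =
      - (g x / r) * ((f x * b - g x * a) / r\<^sup>2)" for a b
  proof -
    have "- f x * (inverse r * ((f x * a + g x * b) / r) * inverse r) + a / r =
        (a * r\<^sup>2 - f x * (f x * a + g x * b)) / (r * r\<^sup>2)"
      using r(1) by (simp add: field_simps power2_eq_square)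
    also have "a * r\<^sup>2 - f x * (f x * a + g x * b) = - (g x * (f x * b - g x * a))"
      unfolding r(2)[symmetric] by (simp add: power2_eq_square algebra_simps)
    also have "- (g x * (f x * b - g x * a)) / (r * r\<^sup>2) = - (g x / r) * ((f x * b - g x * a) / r\<^sup>2)"
      by simp
    finally show ?thesis .
  qed
  ultimately have "((\<lambda>y. f y / sqrt ((f y)\<^sup>2 + (g y)\<^sup>2)) has_derivative
      (\<lambda>v. - (g x / r) * ((f x * g' v - g x * f' v) / r\<^sup>2))) (at x)"
    by (simp only:)
  moreover have "sqrt (r\<^sup>2) = r" using r(1) by simp
  ultimately show ?thesis
    by (simp only: r(2))
qed

text \<open>The rule d exp(ia) = i exp(ia) da, obtained without a branch of a: only its
  single-valued differential appears.\<close>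

lemma has_derivative_unit_complex:
  fixes f g :: "real^3 \<Rightarrow> real"
  assumes "(f has_derivative f') (at x)" "(g has_derivative g') (at x)" "(f x)\<^sup>2 + (g x)\<^sup>2 > 0"
  defines "u \<equiv> \<lambda>y. Complex (f y / sqrt ((f y)\<^sup>2 + (g y)\<^sup>2)) (g y / sqrt ((f y)\<^sup>2 + (g y)\<^sup>2))"
  shows "(u has_derivative
    (\<lambda>v. \<i> * u x * of_real ((f x * g' v - g x * f' v) / ((f x)\<^sup>2 + (g x)\<^sup>2)))) (at x)"
proof -
  note 1 = has_derivative_unit_component[OF assms(1-3)]
  have "(g x)\<^sup>2 + (f x)\<^sup>2 > 0" using assms(3) by linarith
  note 2 = has_derivative_unit_component[OF assms(2,1) this]
  have swap: "- a * ((c - d) / e) = a * ((d - c) / e)" for a c d e :: real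
    by (simp add: diff_divide_distrib algebra_simps)
  have 3: "((\<lambda>y. g y / sqrt ((f y)\<^sup>2 + (g y)\<^sup>2)) has_derivative
    (\<lambda>v. f x / sqrt ((f x)\<^sup>2 + (g x)\<^sup>2) * ((f x * g' v - g x * f' v) / ((f x)\<^sup>2 + (g x)\<^sup>2)))) (at x)"
    using 2 unfolding swap by (simp only: add.commute)
  have "((\<lambda>y. of_real (f y / sqrt ((f y)\<^sup>2 + (g y)\<^sup>2)) + \<i> * of_real (g y / sqrt ((f y)\<^sup>2 + (g y)\<^sup>2)))
      has_derivative (\<lambda>v. \<i> * u x * of_real ((f x * g' v - g x * f' v) / ((f x)\<^sup>2 + (g x)\<^sup>2)))) (at x)"
    by (rule has_derivative_eq_rhs[OF has_derivative_add[OF has_derivative_of_real[OF 1]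
          has_derivative_mult_right[OF has_derivative_of_real[OF 3]]]])
       (simp add: fun_eq_iff complex_eq_iff u_def)
  then show ?thesis
    unfolding u_def Complex_eq .
qed

lemma has_derivative_long_dir:
  assumes "x \<in> toroidal_annulus"
  shows "(long_dir has_derivative (\<lambda>v. \<i> * long_dir x * of_real (d_long x \<bullet> v))) (at x)"
proof -
  have "((\<lambda>y. Complex (y$1 / sqrt ((y$1)\<^sup>2 + (y$2)\<^sup>2)) (y$2 / sqrt ((y$1)\<^sup>2 + (y$2)\<^sup>2))) has_derivative
      (\<lambda>v. \<i> * Complex (x$1 / sqrt ((x$1)\<^sup>2 + (x$2)\<^sup>2)) (x$2 / sqrt ((x$1)\<^sup>2 + (x$2)\<^sup>2))
        * of_real ((x$1 * v$2 - x$2 * v$1) / ((x$1)\<^sup>2 + (x$2)\<^sup>2)))) (at x)"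
    by (rule has_derivative_unit_complex[OF has_derivative_vec_nth has_derivative_vec_nth
          toroidal_annulus_pos(3)[OF assms]])
  moreover have "(x$1 * v$2 - x$2 * v$1) / ((x$1)\<^sup>2 + (x$2)\<^sup>2) = d_long x \<bullet> v" for v
    by (simp add: d_long_def inner_3 diff_divide_distrib)
  ultimately show ?thesis
    by (simp only: long_dir_def[abs_def] axis_dist_def)
qed

lemma has_derivative_mer_dir:
  assumes "x \<in> toroidal_annulus"
  shows "(mer_dir has_derivative (\<lambda>v. - \<i> * mer_dir x * of_real (d_mer x \<bullet> v))) (at x)"
proof -
  note pos = toroidal_annulus_pos[OF assms]
  have N: "(axis_dist y - 2)\<^sup>2 + (- y$3)\<^sup>2 = core_dist2 y" for y
    by (simp add: core_dist2_def)
  have f: "((\<lambda>y. axis_dist y - 2) has_derivative (\<lambda>v. (x$1 * v$1 + x$2 * v$2) / axis_dist x)) (at x)"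
    using has_derivative_diff[OF has_derivative_axis_dist[OF pos(1)] has_derivative_const[of 2]] by simp
  \<comment> \<open>Taking the negative height as second component reverses the angle, whence the
    minus sign in front of \<open>d_mer\<close>.\<close>
  have g: "((\<lambda>y. - y$3) has_derivative (\<lambda>v. - v$3)) (at x)"
    by (intro has_derivative_minus has_derivative_vec_nth)
  have "((\<lambda>y. Complex ((axis_dist y - 2) / sqrt (core_dist2 y)) (- y$3 / sqrt (core_dist2 y))) has_derivative
      (\<lambda>v. \<i> * Complex ((axis_dist x - 2) / sqrt (core_dist2 x)) (- x$3 / sqrt (core_dist2 x))
        * of_real (((axis_dist x - 2) * (- v$3) - (- x$3) * ((x$1 * v$1 + x$2 * v$2) / axis_dist x))
            / core_dist2 x))) (at x)"
    using has_derivative_unit_complex[OF f g] pos(2) unfolding N by blast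
  moreover have "((axis_dist x - 2) * (- v$3) - (- x$3) * ((x$1 * v$1 + x$2 * v$2) / axis_dist x))
      / core_dist2 x = - (d_mer x \<bullet> v)" for v
    using pos by (simp add: d_mer_def inner_3 field_simps)
  ultimately have "(mer_dir has_derivative (\<lambda>v. \<i> * mer_dir x * of_real (- (d_mer x \<bullet> v)))) (at x)"
    by (simp only: mer_dir_def[abs_def])
  then show ?thesis by simp
qed

lemma has_derivative_knot_phase:
  assumes "x \<in> toroidal_annulus" "p > 0" "q > 0"
  shows "(knot_phase p q has_derivative (\<lambda>v. \<i> * knot_phase p q x * of_real (d_phase p q x \<bullet> v))) (at x)"
proof -
  \<comment> \<open>The power rule lowers the exponent by one; for positive exponents the missing
    factor is restored by the logarithmic form of the derivative.\<close>
  have pw: "z ^ n = z ^ (n - 1) * z" if "n > 0" for z :: complex and n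
    using that by (cases n) auto
  show ?thesis
    unfolding knot_phase_def[abs_def]
    by (rule has_derivative_eq_rhs[OF has_derivative_mult[OF
          has_derivative_power[OF has_derivative_long_dir[OF assms(1)]]
          has_derivative_power[OF has_derivative_mer_dir[OF assms(1)]]]])
       (simp add: fun_eq_iff d_phase_def inner_add_left inner_diff_left pw[OF assms(2)] pw[OF assms(3)] algebra_simps)
qed

text \<open>Symmetry of the derivative \<open>D\<close> expresses that the 1-form is closed. Unlike
  a vanishing \<open>ext_deriv\<close>, this form also records differentiability and passes directly
  to linear combinations.\<close>

definition closed_coform :: "(real^3 \<Rightarrow> real^3) \<Rightarrow> real^3 \<Rightarrow> bool" where
  "closed_coform \<alpha> x \<longleftrightarrow> (\<exists>D. (\<forall>w. ((\<lambda>y. \<alpha> y \<bullet> w) has_derivative (\<lambda>v. D v w)) (at x)) \<and> (\<forall>v w. D v w = D w v))"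

lemma closed_coformI:
  assumes "\<And>w. ((\<lambda>y. \<alpha> y \<bullet> w) has_derivative (\<lambda>v. D v w)) (at x)" "\<And>v w. D v w = D w v"
  shows "closed_coform \<alpha> x"
  using assms unfolding closed_coform_def by blast

lemma closed_coform_scaleR:
  assumes "closed_coform \<alpha> x"
  shows "closed_coform (\<lambda>y. s *\<^sub>R \<alpha> y) x"
proof -
  obtain D where D: "\<And>w. ((\<lambda>y. \<alpha> y \<bullet> w) has_derivative (\<lambda>v. D v w)) (at x)" "\<And>v w. D v w = D w v"
    using assms unfolding closed_coform_def by blast
  show ?thesis
  proof (rule closed_coformI)
    show "((\<lambda>y. (s *\<^sub>R \<alpha> y) \<bullet> w) has_derivative (\<lambda>v. s * D v w)) (at x)" for w
      unfolding inner_scaleR_left by (rule has_derivative_mult_right[OF D(1)])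
  qed (simp add: D(2))
qed

lemma closed_coform_add:
  assumes "closed_coform \<alpha> x" "closed_coform \<beta> x"
  shows "closed_coform (\<lambda>y. \<alpha> y + \<beta> y) x"
proof -
  obtain D where D: "\<And>w. ((\<lambda>y. \<alpha> y \<bullet> w) has_derivative (\<lambda>v. D v w)) (at x)" "\<And>v w. D v w = D w v"
    using assms(1) unfolding closed_coform_def by blast
  obtain E where E: "\<And>w. ((\<lambda>y. \<beta> y \<bullet> w) has_derivative (\<lambda>v. E v w)) (at x)" "\<And>v w. E v w = E w v"
    using assms(2) unfolding closed_coform_def by blast
  show ?thesis
  proof (rule closed_coformI)
    show "((\<lambda>y. (\<alpha> y + \<beta> y) \<bullet> w) has_derivative (\<lambda>v. D v w + E v w)) (at x)" for w
      unfolding inner_add_left by (rule has_derivative_add[OF D(1) E(1)])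
    show "D v w + E v w = D w v + E w v" for v w
      by (simp only: D(2)[of v] E(2)[of v])
  qed
qed

text \<open>The Leibniz rule d(f a) = df a + f da with da = 0: the terms containing
  \<open>A\<close>, \<open>B\<close>, \<open>C\<close> are symmetric and drop out of the alternating
  difference. An identity for \<open>\<omega>\<close> on an open set suffices because derivatives
  are local.\<close>

lemma ext_deriv_closed_coframe:
  assumes "closed_coform a x" "closed_coform b x" "closed_coform c x"
    and f: "(f has_derivative f') (at x)" "(g has_derivative g') (at x)" "(h has_derivative h') (at x)"
    and U: "open U" "x \<in> U"
    and \<omega>: "\<And>y w. y \<in> U \<Longrightarrow> \<omega> y w = f y * (a y \<bullet> w) + g y * (b y \<bullet> w) + h y * (c y \<bullet> w)"
  shows "ext_deriv \<omega> x v w = (f' v * (a x \<bullet> w) - f' w * (a x \<bullet> v))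
    + (g' v * (b x \<bullet> w) - g' w * (b x \<bullet> v)) + (h' v * (c x \<bullet> w) - h' w * (c x \<bullet> v))"
proof -
  obtain A where A: "\<And>w. ((\<lambda>y. a y \<bullet> w) has_derivative (\<lambda>v. A v w)) (at x)" "\<And>v w. A v w = A w v"
    using assms(1) unfolding closed_coform_def by blast
  obtain B where B: "\<And>w. ((\<lambda>y. b y \<bullet> w) has_derivative (\<lambda>v. B v w)) (at x)" "\<And>v w. B v w = B w v"
    using assms(2) unfolding closed_coform_def by blast
  obtain C where C: "\<And>w. ((\<lambda>y. c y \<bullet> w) has_derivative (\<lambda>v. C v w)) (at x)" "\<And>v w. C v w = C w v"
    using assms(3) unfolding closed_coform_def by blast
  have "((\<lambda>y. \<omega> y w) has_derivative (\<lambda>v. (f x * A v w + f' v * (a x \<bullet> w))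
      + (g x * B v w + g' v * (b x \<bullet> w)) + (h x * C v w + h' v * (c x \<bullet> w)))) (at x)" for w
    by (rule has_derivative_transform_within_open[OF has_derivative_add[OF has_derivative_add[OF
          has_derivative_mult[OF f(1) A(1)] has_derivative_mult[OF f(2) B(1)]]
          has_derivative_mult[OF f(3) C(1)]] U])
       (simp add: \<omega>)
  then have "frechet_derivative (\<lambda>y. \<omega> y w) (at x) = (\<lambda>v. (f x * A v w + f' v * (a x \<bullet> w))
      + (g x * B v w + g' v * (b x \<bullet> w)) + (h x * C v w + h' v * (c x \<bullet> w)))" for w
    by (rule frechet_derivative_at[symmetric])
  then show ?thesis
    unfolding ext_deriv_def by (simp add: A(2)[of w v] B(2)[of w v] C(2)[of w v])
qed

lemma closed_d_long:
  assumes "x \<in> toroidal_annulus"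
  shows "closed_coform d_long x"
proof (rule closed_coformI)
  define S where "S = (x$1)\<^sup>2 + (x$2)\<^sup>2"
  define D where "D v w = (v$1 * w$2 - v$2 * w$1) / S
    - (x$1 * w$2 - x$2 * w$1) * (2 * (x$1 * v$1 + x$2 * v$2)) / S\<^sup>2" for v w :: "real^3"
  have S: "S > 0" using toroidal_annulus_pos(3)[OF assms] by (simp add: S_def)
  show "((\<lambda>y. d_long y \<bullet> w) has_derivative (\<lambda>v. D v w)) (at x)" for w
  proof -
    have 1: "((\<lambda>y. y$1 * w$2 - y$2 * w$1) has_derivative (\<lambda>v. v$1 * w$2 - v$2 * w$1)) (at x)"
      by (intro has_derivative_diff has_derivative_mult_left has_derivative_vec_nth)
    have 2: "((\<lambda>y. (y$1)\<^sup>2 + (y$2)\<^sup>2) has_derivative (\<lambda>v. 2 * (x$1 * v$1 + x$2 * v$2))) (at x)"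
      by (auto intro!: derivative_eq_intros has_derivative_vec_nth simp: fun_eq_iff algebra_simps)
    have "((\<lambda>y. (y$1 * w$2 - y$2 * w$1) / ((y$1)\<^sup>2 + (y$2)\<^sup>2)) has_derivative (\<lambda>v. D v w)) (at x)"
      by (rule has_derivative_eq_rhs[OF has_derivative_divide[OF 1 2]])
         (use S in \<open>simp only: S_def[symmetric]\<close>, simp only: S_def[symmetric] D_def,
          simp add: fun_eq_iff divide_inverse power2_eq_square algebra_simps)
    then show ?thesis
      by (simp add: d_long_def inner_3 diff_divide_distrib)
  qed
  show "D v w = D w v" for v w
  proof -
    \<comment> \<open>Over the common denominator \<open>S\<^sup>2\<close> symmetry becomes a
      polynomial identity in the coordinates.\<close>
    have "(v$1 * w$2 - v$2 * w$1) / S = (v$1 * w$2 - v$2 * w$1) * ((x$1)\<^sup>2 + (x$2)\<^sup>2) / S\<^sup>2"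
      "(w$1 * v$2 - w$2 * v$1) / S = (w$1 * v$2 - w$2 * v$1) * ((x$1)\<^sup>2 + (x$2)\<^sup>2) / S\<^sup>2"
      unfolding S_def[symmetric] using S by (simp_all add: power2_eq_square)
    then show ?thesis
      unfolding D_def by (simp add: diff_divide_distrib[symmetric])
        (simp add: power2_eq_square algebra_simps)
  qed
qed

lemma d_core_inner:
  "d_core y \<bullet> w = 2 * (axis_dist y - 2) * ((y$1 * w$1 + y$2 * w$2) / axis_dist y) + 2 * (y$3 * w$3)"
proof -
  have "2 * m * a / R * c + 2 * m * b / R * d + 2 * z * e = 2 * m * ((a * c + b * d) / R) + 2 * (z * e)"
    for m a b c d e z R :: real
    by (simp add: divide_inverse algebra_simps)
  then show ?thesis
    unfolding d_core_def inner_3 vector_3 .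
qed

lemma closed_d_core:
  assumes "x \<in> toroidal_annulus"
  shows "closed_coform d_core x"
proof (rule closed_coformI)
  note pos = toroidal_annulus_pos[OF assms]
  define P where "P v = (x$1 * v$1 + x$2 * v$2) / axis_dist x" for v :: "real^3"
  \<comment> \<open>The Hessian of \<open>core_dist2\<close>. The bracket divided by
    \<open>axis_dist x\<close> is the Hessian of \<open>axis_dist\<close>, and \<open>P\<close> is
    its differential.\<close>
  define D where "D v w = 2 * (v$1 * w$1 + v$2 * w$2) + 2 * (v$3 * w$3)
    - 4 * ((v$1 * w$1 + v$2 * w$2) - P v * P w) / axis_dist x" for v w
  note dR = has_derivative_axis_dist[OF pos(1), folded P_def]
  show "((\<lambda>y. d_core y \<bullet> w) has_derivative (\<lambda>v. D v w)) (at x)" for w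
  proof -
    have 1: "((\<lambda>y. y$1 * w$1 + y$2 * w$2) has_derivative (\<lambda>v. v$1 * w$1 + v$2 * w$2)) (at x)"
      by (intro has_derivative_add has_derivative_mult_left has_derivative_vec_nth)
    have "((\<lambda>y. 2 * (axis_dist y - 2) * ((y$1 * w$1 + y$2 * w$2) / axis_dist y) + 2 * (y$3 * w$3))
        has_derivative (\<lambda>v. D v w)) (at x)"
      using pos(1)
      by (auto intro!: derivative_eq_intros 1 dR has_derivative_vec_nth
          simp: fun_eq_iff D_def field_simps)
        (simp add: P_def field_simps power2_eq_square)
    then show ?thesis
      by (simp only: d_core_inner)
  qed
  show "D v w = D w v" for v w
    by (simp add: D_def algebra_simps)
qed

lemma closed_d_mer:
  assumes "x \<in> toroidal_annulus"
  shows "closed_coform d_mer x"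
proof (rule closed_coformI)
  note pos = toroidal_annulus_pos[OF assms]
  define R N m where "R = axis_dist x" and "N = core_dist2 x" and "m = axis_dist x - 2"
  have R: "R > 0" and N: "N > 0" "N = m\<^sup>2 + (x$3)\<^sup>2"
    using pos by (simp_all add: R_def N_def m_def core_dist2_def)
  define P where "P v = (x$1 * v$1 + x$2 * v$2) / R" for v :: "real^3"
  \<comment> \<open>The quotient rule for d theta = (m dz - z dR) / N, where R is
    \<open>axis_dist\<close> and z the height.\<close>
  define D where "D v w = (P v * w$3 - v$3 * P w - x$3 * ((v$1 * w$1 + v$2 * w$2) - P v * P w) / R) / N
    - (m * w$3 - x$3 * P w) * (2 * m * P v + 2 * x$3 * v$3) / N\<^sup>2" for v w
  have dR: "(axis_dist has_derivative P) (at x)"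
    using has_derivative_axis_dist[OF pos(1)] unfolding P_def[abs_def] R_def .
  have dN: "(core_dist2 has_derivative (\<lambda>v. 2 * m * P v + 2 * x$3 * v$3)) (at x)"
    using has_derivative_core_dist2[OF pos(1)]
    unfolding d_core_inner P_def m_def R_def by (simp only: mult.assoc)
  show "((\<lambda>y. d_mer y \<bullet> w) has_derivative (\<lambda>v. D v w)) (at x)" for w
  proof -
    have 1: "((\<lambda>y. y$1 * w$1 + y$2 * w$2) has_derivative (\<lambda>v. v$1 * w$1 + v$2 * w$2)) (at x)"
      by (intro has_derivative_add has_derivative_mult_left has_derivative_vec_nth)
    have 2: "((\<lambda>y. (y$1 * w$1 + y$2 * w$2) / axis_dist y) has_derivative
        (\<lambda>v. ((v$1 * w$1 + v$2 * w$2) - P v * P w) / R)) (at x)"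
      by (rule has_derivative_eq_rhs[OF has_derivative_divide[OF 1 dR]])
         (use R in \<open>simp_all add: R_def[symmetric] fun_eq_iff P_def[of w] divide_inverse algebra_simps\<close>)
    have 3: "((\<lambda>y. (axis_dist y - 2) * w$3 - y$3 * ((y$1 * w$1 + y$2 * w$2) / axis_dist y)) has_derivative
        (\<lambda>v. P v * w$3 - (x$3 * (((v$1 * w$1 + v$2 * w$2) - P v * P w) / R) + v$3 * P w))) (at x)"
      by (rule has_derivative_eq_rhs[OF has_derivative_diff[OF has_derivative_mult_left[OF has_derivative_diff[OF dR has_derivative_const]]
            has_derivative_mult[OF has_derivative_vec_nth 2]]])
         (simp add: P_def[of w] R_def)
    have "((\<lambda>y. ((axis_dist y - 2) * w$3 - y$3 * ((y$1 * w$1 + y$2 * w$2) / axis_dist y)) / core_dist2 y)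
        has_derivative (\<lambda>v. D v w)) (at x)"
      by (rule has_derivative_eq_rhs[OF has_derivative_divide[OF 3 dN]])
         (use N(1) in \<open>simp only: N_def[symmetric]\<close>, simp only: m_def[symmetric],
          simp only: R_def[symmetric] N_def[symmetric], simp only: P_def[symmetric] D_def,
          simp add: fun_eq_iff divide_inverse power2_eq_square algebra_simps)
    moreover have "((axis_dist y - 2) * w$3 - y$3 * ((y$1 * w$1 + y$2 * w$2) / axis_dist y)) / core_dist2 y
        = d_mer y \<bullet> w" for y
      by (simp add: d_mer_def inner_3 divide_inverse algebra_simps)
    ultimately show ?thesis by simp
  qed
  show "D v w = D w v" for v w
  proof -
    \<comment> \<open>The term with the Hessian of \<open>axis_dist\<close> is symmetric by itself.
      The others become comparable over the denominator \<open>N\<^sup>2\<close>, once one factor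
      \<open>N\<close> is written as a sum of squares.\<close>
    have "(P v * w$3 - v$3 * P w) / N = (P v * w$3 - v$3 * P w) * (m\<^sup>2 + (x$3)\<^sup>2) / N\<^sup>2" for v w
      unfolding N(2)[symmetric] using N(1) by (simp add: power2_eq_square)
    then have D_eq: "D v w = ((P v * w$3 - v$3 * P w) * (m\<^sup>2 + (x$3)\<^sup>2)
        - (m * w$3 - x$3 * P w) * (2 * m * P v + 2 * x$3 * v$3)) / N\<^sup>2
        - (x$3 * ((v$1 * w$1 + v$2 * w$2) - P v * P w) / R) / N" for v w
      by (simp add: D_def diff_divide_distrib)
    show ?thesis
      unfolding D_eq[of v w] D_eq[of w v] by (simp add: power2_eq_square algebra_simps)
  qed
qed

text \<open>The derivatives of the first two coefficients contribute cos u du ds + cos s ds du,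
  which is C ds du. The third contributes dC dw, that is, sin u du dw + sin s dw ds. The results are
  the original coefficients on the dual 2-forms.\<close>

lemma curl_knot_field:
  assumes x: "x \<in> toroidal_annulus" and p: "p > 0" and q: "q > 0" and l: "l > 0"
  shows "riemannian_curl (knot_metric p q l) (knot_field p q l) x = knot_field p q l x"
proof (rule riemannian_curl_coframe[OF knot_metric_def])
  note pos = toroidal_annulus_pos[OF x]
  show "det (vector [d_core x, d_phase p q x, l *\<^sub>R d_long x] :: real^3^3) > 0"
    using pos q l by (simp add: det_coframe[OF x])
  fix v w
  let ?E = "knot_phase p q"
  note dE = has_derivative_knot_phase[OF x p q]
  note dN = has_derivative_diff[OF has_derivative_core_dist2[OF pos(1)] has_derivative_const[of 1]]
  have f: "((\<lambda>y. Im (?E y)) has_derivative (\<lambda>v. Re (?E x) * (d_phase p q x \<bullet> v))) (at x)"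
    using has_derivative_Im[OF dE] by simp
  have e: "((\<lambda>y. Re (?E y)) has_derivative (\<lambda>v. - Im (?E x) * (d_phase p q x \<bullet> v))) (at x)"
    using has_derivative_Re[OF dE] by simp
  have g: "((\<lambda>y. sin (core_dist2 y - 1)) has_derivative (\<lambda>v. cos (core_dist2 x - 1) * (d_core x \<bullet> v))) (at x)"
    using has_derivative_sin[OF dN] by (simp add: mult.commute)
  have c: "((\<lambda>y. cos (core_dist2 y - 1)) has_derivative (\<lambda>v. - sin (core_dist2 x - 1) * (d_core x \<bullet> v))) (at x)"
    using has_derivative_cos[OF dN] by (simp add: mult.commute)
  have cl: "closed_coform (d_phase p q) x" "closed_coform (\<lambda>y. l *\<^sub>R d_long y) x"
    unfolding d_phase_def[abs_def]
    by (intro closed_coform_add closed_coform_scaleR closed_d_long[OF x] closed_d_mer[OF x])+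
  have "ext_deriv (flat_form (knot_metric p q l) (knot_field p q l)) x v w =
      (Re (?E x) * (d_phase p q x \<bullet> v) * (d_core x \<bullet> w) - Re (?E x) * (d_phase p q x \<bullet> w) * (d_core x \<bullet> v))
      + (cos (core_dist2 x - 1) * (d_core x \<bullet> v) * (d_phase p q x \<bullet> w)
          - cos (core_dist2 x - 1) * (d_core x \<bullet> w) * (d_phase p q x \<bullet> v))
      + ((- sin (core_dist2 x - 1) * (d_core x \<bullet> v) - - Im (?E x) * (d_phase p q x \<bullet> v)) * ((l *\<^sub>R d_long x) \<bullet> w)
          - (- sin (core_dist2 x - 1) * (d_core x \<bullet> w) - - Im (?E x) * (d_phase p q x \<bullet> w)) * ((l *\<^sub>R d_long x) \<bullet> v))"
    by (rule ext_deriv_closed_coframe[OF closed_d_core[OF x] cl f g has_derivative_diff[OF c e]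
          open_toroidal_annulus x])
       (simp only: flat_form_def knot_metric_def coframe_metric_def coframe_knot_field[OF _ q l])
  then show "ext_deriv (flat_form (knot_metric p q l) (knot_field p q l)) x v w =
      (d_core x \<bullet> knot_field p q l x) * ((d_phase p q x \<bullet> v) * ((l *\<^sub>R d_long x) \<bullet> w) - (d_phase p q x \<bullet> w) * ((l *\<^sub>R d_long x) \<bullet> v))
      + (d_phase p q x \<bullet> knot_field p q l x) * (((l *\<^sub>R d_long x) \<bullet> v) * (d_core x \<bullet> w) - ((l *\<^sub>R d_long x) \<bullet> w) * (d_core x \<bullet> v))
      + ((l *\<^sub>R d_long x) \<bullet> knot_field p q l x) * ((d_core x \<bullet> v) * (d_phase p q x \<bullet> w) - (d_core x \<bullet> w) * (d_phase p q x \<bullet> v))"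
    unfolding coframe_knot_field[OF x q l] by (simp only:) (simp add: algebra_simps)
qed

section \<open>The zero set\<close>

lemma knot_field_eq_0_iff:
  assumes "x \<in> toroidal_annulus" "q > 0" "l > 0"
  shows "knot_field p q l x = 0 \<longleftrightarrow> core_dist2 x = 1 \<and> knot_phase p q x = 1"
proof
  assume 0: "knot_field p q l x = 0"
  have 1: "Im (knot_phase p q x) = 0" "sin (core_dist2 x - 1) = 0"
    "cos (core_dist2 x - 1) = Re (knot_phase p q x)"
    using coframe_knot_field[OF assms, of p] unfolding 0 by simp_all
  have "core_dist2 x - 1 = 0"
    by (rule sin_eq_0_pi) (use 1(2) assms(1) pi_gt3 in \<open>auto simp: toroidal_annulus_iff\<close>)
  then show "core_dist2 x = 1 \<and> knot_phase p q x = 1"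
    using 1 by (simp add: complex_eq_iff)
next
  assume "core_dist2 x = 1 \<and> knot_phase p q x = 1"
  then show "knot_field p q l x = 0" by (simp add: knot_field_def)
qed

lemma unit_circle_coordinates:
  assumes "x \<in> toroidal_annulus" "core_dist2 x = 1"
  obtains \<phi> \<theta> where "x$1 = axis_dist x * cos \<phi>" "x$2 = axis_dist x * sin \<phi>"
    "axis_dist x = 2 + cos \<theta>" "x$3 = sin \<theta>"
proof -
  note pos = toroidal_annulus_pos[OF assms(1)]
  have "(x$1 / axis_dist x)\<^sup>2 + (x$2 / axis_dist x)\<^sup>2 = ((x$1)\<^sup>2 + (x$2)\<^sup>2) / (axis_dist x)\<^sup>2"
    by (simp only: power_divide add_divide_distrib)
  also have "\<dots> = 1"
    using pos by (simp only: axis_dist_sq[symmetric]) simp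
  finally obtain \<phi> where "x$1 / axis_dist x = cos \<phi>" "x$2 / axis_dist x = sin \<phi>"
    using sincos_total_2pi by metis
  moreover have "(axis_dist x - 2)\<^sup>2 + (x$3)\<^sup>2 = 1"
    using assms(2) by (simp add: core_dist2_def)
  then obtain \<theta> where "axis_dist x - 2 = cos \<theta>" "x$3 = sin \<theta>"
    using sincos_total_2pi by metis
  ultimately show ?thesis
    using that[of \<phi> \<theta>] pos by (simp add: field_simps)
qed

lemma knot_phase_cis:
  assumes "axis_dist x > 0" "core_dist2 x = 1" "x$1 = axis_dist x * cos \<phi>" "x$2 = axis_dist x * sin \<phi>"
    "axis_dist x = 2 + cos \<theta>" "x$3 = sin \<theta>"
  shows "knot_phase p q x = cis (real p * \<phi> - real q * \<theta>)"
proof -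
  have "x$1 / axis_dist x = cos \<phi>" "x$2 / axis_dist x = sin \<phi>"
    unfolding assms(3,4) using assms(1) by simp_all
  then have "long_dir x = cis \<phi>"
    by (simp add: long_dir_def complex_eq_iff)
  moreover have "mer_dir x = cis (- \<theta>)"
    by (simp add: mer_dir_def assms(2,5,6) complex_eq_iff)
  ultimately show ?thesis
    by (simp only: knot_phase_def Complex.DeMoivre cis_mult mult_minus_right diff_conv_add_uminus)
qed

lemma torus_curve_coordinates:
  "axis_dist (torus_curve p q t) = 2 + cos (real p * t)" "core_dist2 (torus_curve p q t) = 1"
proof -
  have "2 + cos (real p * t) \<ge> 0" using cos_ge_minus_one[of "real p * t"] by linarith
  moreover have "(cos (real q * t) * (2 + cos (real p * t)))\<^sup>2 + (sin (real q * t) * (2 + cos (real p * t)))\<^sup>2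
      = (2 + cos (real p * t))\<^sup>2"
    by (simp add: power_mult_distrib distrib_right[symmetric])
  ultimately show 1: "axis_dist (torus_curve p q t) = 2 + cos (real p * t)"
    by (simp add: axis_dist_def torus_curve_def)
  show "core_dist2 (torus_curve p q t) = 1"
    unfolding core_dist2_def 1 by (simp add: torus_curve_def)
qed

text \<open>On the core torus the phase \<open>p \<phi> - q \<theta>\<close> is a multiple of \<open>2 \<pi>\<close>; a Bezout relation for
  \<open>p\<close> and \<open>q\<close> turns this into a common parameter \<open>t\<close> with \<open>\<phi> = q t\<close>, \<open>\<theta> = p t\<close> modulo \<open>2 \<pi>\<close>.\<close>

lemma zero_set_knot_field:
  assumes "q > 0" "l > 0" "coprime p q"
  shows "{x \<in> toroidal_annulus. knot_field p q l x = 0} = torus_knot p q"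
proof (intro equalityI subsetI)
  fix x assume "x \<in> {x \<in> toroidal_annulus. knot_field p q l x = 0}"
  then have x: "x \<in> toroidal_annulus" and N: "core_dist2 x = 1" and E: "knot_phase p q x = 1"
    using knot_field_eq_0_iff assms by auto
  obtain \<phi> \<theta> where co: "x$1 = axis_dist x * cos \<phi>" "x$2 = axis_dist x * sin \<phi>"
    "axis_dist x = 2 + cos \<theta>" "x$3 = sin \<theta>"
    using unit_circle_coordinates[OF x N] .
  have "cos (real p * \<phi> - real q * \<theta>) = 1"
    using E unfolding knot_phase_cis[OF toroidal_annulus_pos(1)[OF x] N co] by (simp add: complex_eq_iff)
  then obtain n :: int where n: "real p * \<phi> - real q * \<theta> = of_int n * 2 * pi"
    using cos_one_2pi_int by auto
  have "gcd (int p) (int q) = 1"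
    using assms(3) by simp
  then obtain i j :: int where "i * int p + j * int q = 1"
    using bezout_int[of "int p" "int q"] by auto
  then have "real_of_int (i * int p + j * int q) = 1" by simp
  then have ij: "of_int i * real p + of_int j * real q = 1" by simp
  \<comment> \<open>If phi = q t and theta = p t held exactly, the Bezout relation would give t = j
    phi + i theta; in general the error is a multiple of 2 pi.\<close>
  define t where "t = of_int j * \<phi> + of_int i * \<theta>"
  have "real q * t = of_int j * real q * \<phi> + of_int i * (real q * \<theta>)"
    by (simp add: t_def algebra_simps)
  also have "real q * \<theta> = real p * \<phi> - of_int n * 2 * pi" using n by simp
  also have "of_int j * real q * \<phi> + of_int i * (real p * \<phi> - of_int n * 2 * pi)
      = (of_int i * real p + of_int j * real q) * \<phi> - of_int (i * n) * 2 * pi"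
    by (simp add: algebra_simps)
  also have "\<dots> = \<phi> + of_int (- (i * n)) * (2 * pi)"
    unfolding ij by simp
  finally have qt: "real q * t = \<phi> + of_int (- (i * n)) * (2 * pi)" .
  have "real p * t = of_int j * (real p * \<phi>) + of_int i * real p * \<theta>"
    by (simp add: t_def algebra_simps)
  also have "real p * \<phi> = real q * \<theta> + of_int n * 2 * pi" using n by simp
  also have "of_int j * (real q * \<theta> + of_int n * 2 * pi) + of_int i * real p * \<theta>
      = (of_int i * real p + of_int j * real q) * \<theta> + of_int (j * n) * 2 * pi"
    by (simp add: algebra_simps)
  also have "\<dots> = \<theta> + of_int (j * n) * (2 * pi)"
    unfolding ij by simp
  finally have pt: "real p * t = \<theta> + of_int (j * n) * (2 * pi)" .
  have periodic: "cos (s + of_int m * (2 * pi)) = cos s" "sin (s + of_int m * (2 * pi)) = sin s"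
    for s :: real and m :: int
    using cos_int_2pin[of m] sin_int_2pin[of m] by (simp_all add: cos_add sin_add mult.commute)
  have "torus_curve p q t = x"
    by (rule vec3_eqI) (simp_all only: torus_curve_def vector_3 qt pt periodic co, simp_all)
  then show "x \<in> torus_knot p q"
    unfolding torus_knot_def by blast
next
  fix x assume "x \<in> torus_knot p q"
  then obtain t where t: "x = torus_curve p q t"
    unfolding torus_knot_def by blast
  note co = torus_curve_coordinates[of p q t, folded t]
  have x: "x \<in> toroidal_annulus" using co by (simp add: toroidal_annulus_iff)
  have "knot_phase p q x = cis (real p * (real q * t) - real q * (real p * t))"
    by (rule knot_phase_cis[OF toroidal_annulus_pos(1)[OF x] co(2)])
       (simp_all only: co(1), simp_all add: t torus_curve_def mult.commute)
  then have "knot_phase p q x = 1" by (simp add: algebra_simps)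
  with x co show "x \<in> {x \<in> toroidal_annulus. knot_field p q l x = 0}"
    using knot_field_eq_0_iff assms by auto
qed

section \<open>Analyticity and closed formulas in Cartesian coordinates\<close>

lemma analytic_elementary_knot:
  defines "U \<equiv> toroidal_annulus"
  shows "analytic_elementary_on U axis_dist" "analytic_elementary_on U core_dist2"
    "analytic_elementary_on U (\<lambda>x. Re (knot_phase p q x))" "analytic_elementary_on U (\<lambda>x. Im (knot_phase p q x))"
    "analytic_elementary_on U (\<lambda>x. d_core x $ i)" "analytic_elementary_on U (\<lambda>x. d_long x $ i)"
    "analytic_elementary_on U (\<lambda>x. d_mer x $ i)"
    "analytic_elementary_on U (\<lambda>x. e_core x $ i)" "analytic_elementary_on U (\<lambda>x. e_long x $ i)"
    "analytic_elementary_on U (\<lambda>x. e_mer x $ i)"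
proof -
  note pos = toroidal_annulus_pos[folded U_def]
  note I = analytic_elementary_intros
  show R: "analytic_elementary_on U axis_dist"
    unfolding axis_dist_def[abs_def] by (intro I) (use pos in auto)
  show N: "analytic_elementary_on U core_dist2"
    unfolding core_dist2_def[abs_def] by (intro I R)
  have "analytic_elementary_on U (\<lambda>x. Re (long_dir x))" "analytic_elementary_on U (\<lambda>x. Im (long_dir x))"
    "analytic_elementary_on U (\<lambda>x. Re (mer_dir x))" "analytic_elementary_on U (\<lambda>x. Im (mer_dir x))"
    unfolding long_dir_def mer_dir_def complex.sel by (intro I R N; use pos in simp)+
  then have "analytic_elementary_on U (\<lambda>x. Re (long_dir x ^ p))" "analytic_elementary_on U (\<lambda>x. Im (long_dir x ^ p))"
    "analytic_elementary_on U (\<lambda>x. Re (mer_dir x ^ q))" "analytic_elementary_on U (\<lambda>x. Im (mer_dir x ^ q))"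
    using analytic_elementary_complex_power by blast+
  then show "analytic_elementary_on U (\<lambda>x. Re (knot_phase p q x))" "analytic_elementary_on U (\<lambda>x. Im (knot_phase p q x))"
    unfolding knot_phase_def by (auto intro!: I)
  have all: "P i" if "P 1" "P 2" "P 3" for P :: "3 \<Rightarrow> bool" and i
    using that exhaust_3 by metis
  have S: "(x$1)\<^sup>2 + (x$2)\<^sup>2 > 0" if "x \<in> U" for x
    using pos(3)[OF that] .
  show "analytic_elementary_on U (\<lambda>x. d_core x $ i)" "analytic_elementary_on U (\<lambda>x. d_long x $ i)"
    "analytic_elementary_on U (\<lambda>x. d_mer x $ i)"
    "analytic_elementary_on U (\<lambda>x. e_core x $ i)" "analytic_elementary_on U (\<lambda>x. e_long x $ i)"
    "analytic_elementary_on U (\<lambda>x. e_mer x $ i)"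
    by (rule all[of _ i];
        simp only: d_core_def d_long_def d_mer_def e_core_def e_long_def e_mer_def vector_3;
        intro I R N S mult_pos_pos pos zero_less_numeral; assumption?)+
qed

lemma analytic_elementary_knot_metric:
  "analytic_elementary_on toroidal_annulus (metric_component (knot_metric p q l) i j)"
  unfolding metric_component_def[abs_def] knot_metric_def coframe_metric_def inner_axis d_phase_def
    vector_add_component vector_scaleR_component
  by (simp, intro analytic_elementary_intros analytic_elementary_knot)

lemma analytic_elementary_knot_field:
  "analytic_elementary_on toroidal_annulus (\<lambda>x. knot_field p q l x $ i)"
  unfolding knot_field_def vector_add_component vector_scaleR_component real_scaleR_def
  by (intro analytic_elementary_intros analytic_elementary_knot)

section \<open>Separating the members of the family\<close>

lemma distinct_parameters:
  fixes l m :: real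
  assumes "l > 0" "m > 0" "l \<noteq> m"
  defines "x \<equiv> vector [13/4, 0, 0] :: real^3"
  shows "x \<in> toroidal_annulus" "knot_metric p q l x \<noteq> knot_metric p q m x"
    "knot_field p q l x \<noteq> knot_field p q m x"
proof -
  have x: "x$1 = 13/4" "x$2 = 0" "x$3 = 0" by (simp_all add: x_def)
  \<comment> \<open>The test point lies at distance 5/4 from the core circle, with both angles zero
    and s = 9/16. It is off the knot: the phase is 1, but C = cos(9/16) - 1 is nonzero, so the field
    depends on the parameter there.\<close>
  have R: "axis_dist x = 13/4" by (simp add: axis_dist_def x)
  have N: "core_dist2 x = 25/16" by (simp add: core_dist2_def R x power2_eq_square)
  have rN: "sqrt (25/16) = (5/4 :: real)" by (rule real_sqrt_unique) (simp_all add: power2_eq_square)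
  show "x \<in> toroidal_annulus" by (simp add: toroidal_annulus_iff N)
  have "long_dir x = 1" "mer_dir x = 1"
    by (simp_all add: long_dir_def mer_dir_def R N rN x complex_eq_iff)
  then have E: "knot_phase p q x = 1" by (simp add: knot_phase_def)
  have g: "knot_metric p q s x (axis 2 1) (axis 2 1) = (real p * 4 / 13)\<^sup>2 + (s * 4 / 13)\<^sup>2" for s
    by (simp add: knot_metric_def coframe_metric_def inner_axis d_core_def d_phase_def d_long_def d_mer_def
        R N x power2_eq_square)
  show "knot_metric p q l x \<noteq> knot_metric p q m x"
  proof
    assume "knot_metric p q l x = knot_metric p q m x"
    then have "(l * 4 / 13)\<^sup>2 = (m * 4 / 13)\<^sup>2" using g[of l] g[of m] by simp
    then have "l * 4 / 13 = m * 4 / 13" by (rule power2_eq_imp_eq) (use assms in auto)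
    with assms show False by simp
  qed
  have "sin (9/16 :: real) > 0" by (rule sin_gt_zero) (use pi_gt3 in auto)
  then have c: "cos (9/16 :: real) \<noteq> 1"
    using sin_cos_squared_add[of "9/16 :: real"] by (auto simp: power2_eq_square)
  have X: "knot_field p q s x $ 2 = (cos (9/16) - 1) * (13/4) / s" for s
    by (simp add: knot_field_def e_core_def e_mer_def e_long_def E R N x)
  show "knot_field p q l x \<noteq> knot_field p q m x"
  proof
    assume "knot_field p q l x = knot_field p q m x"
    then have "(cos (9/16) - 1) * (13/4) / l = (cos (9/16) - 1) * (13/4) / m"
      by (simp only: X[symmetric])
    with assms c show False by simp
  qed
qed

theorem theorem2p7:
  fixes p q :: nat
  assumes "p > 0" and "q > 0" and "coprime p q"
  shows "\<exists>(g :: int \<Rightarrow> metric_field) (X :: int \<Rightarrow> vector_field).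
      (\<forall>k. analytic_riemannian_metric_on (g k) toroidal_annulus) \<and>
      (\<forall>k. analytic_vector_field_on (X k) toroidal_annulus) \<and>
      (\<forall>j k. j \<noteq> k \<longrightarrow> (\<exists>x\<in>toroidal_annulus. g j x \<noteq> g k x)) \<and>
      (\<forall>j k. j \<noteq> k \<longrightarrow> (\<exists>x\<in>toroidal_annulus. X j x \<noteq> X k x)) \<and>
      (\<forall>k. \<forall>x\<in>toroidal_annulus. riemannian_curl (g k) (X k) x = X k x) \<and>
      (\<forall>k. {x \<in> toroidal_annulus. X k x = 0} = torus_knot p q) \<and>
      (\<forall>k. elementary_metric_on (g k) toroidal_annulus) \<and>
      (\<forall>k. elementary_vector_field_on (X k) toroidal_annulus)"
proof -
  \<comment> \<open>An injective family of positive parameters indexed by the integers.\<close>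
  define l :: "int \<Rightarrow> real" where "l k = exp (of_int k)" for k
  have l: "l k > 0" "j \<noteq> k \<Longrightarrow> l j \<noteq> l k" for j k
    by (simp_all add: l_def)
  let ?g = "\<lambda>k. knot_metric p q (l k)" and ?X = "\<lambda>k. knot_field p q (l k)"
  have inner: "is_inner_product (?g k x)" if "x \<in> toroidal_annulus" for k x
    unfolding knot_metric_def
    by (rule is_inner_product_coframe)
       (use toroidal_annulus_pos[OF that] assms l in \<open>simp add: det_coframe[OF that] less_imp_neq[symmetric]\<close>)
  show ?thesis
  proof (intro exI[of _ ?g] exI[of _ ?X] conjI allI ballI impI)
    fix k
    show "analytic_riemannian_metric_on (?g k) toroidal_annulus"
      using inner analytic_elementary_knot_metric
      by (auto simp: analytic_riemannian_metric_on_def analytic_elementary_on_def intro!: real_analytic_onI)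
    show "analytic_vector_field_on (?X k) toroidal_annulus"
      using analytic_elementary_knot_field
      by (auto simp: analytic_vector_field_on_def analytic_elementary_on_def intro!: real_analytic_onI)
    show "elementary_metric_on (?g k) toroidal_annulus"
      using analytic_elementary_knot_metric
      by (auto simp: elementary_metric_on_def analytic_elementary_on_def)
    show "elementary_vector_field_on (?X k) toroidal_annulus"
      using analytic_elementary_knot_field
      by (auto simp: elementary_vector_field_on_def analytic_elementary_on_def)
    show "{x \<in> toroidal_annulus. ?X k x = 0} = torus_knot p q"
      by (rule zero_set_knot_field) (use assms l in auto)
    show "riemannian_curl (?g k) (?X k) x = ?X k x" if "x \<in> toroidal_annulus" for x
      by (rule curl_knot_field) (use that assms l in auto)
    fix j assume jk: "j \<noteq> k"
    note d = distinct_parameters[OF l(1) l(1) l(2)[OF jk]]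
    show "\<exists>x\<in>toroidal_annulus. ?g j x \<noteq> ?g k x" "\<exists>x\<in>toroidal_annulus. ?X j x \<noteq> ?X k x"
      using d by blast+
  qed
qed

end
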